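(* Let $m\ge 1$ be an integer, let $1\le q<\infty$, and let $\boldsymbol\alpha=(\boldsymbol\alpha_0,\dots,\boldsymbol\alpha_m)$ with $\boldsymbol\alpha_r>0$ for all $r$. Then there is a constant $\kappa_{\boldsymbol\alpha}$, depending only on $\boldsymbol\alpha$ (in particular not on $n$), such that for every integer $n\ge 1$ the Hausdorff distance between the multiball of periodic zero-order splines and the periodic Sobolev multiball satisfies $$d_{\mathcal H}\big(\mathcal S^{m,q}_{\sharp,n}(\boldsymbol\alpha),\,W^{m,q}_\sharp(\boldsymbol\alpha)\big)\le \frac{\kappa_{\boldsymbol\alpha}}{n}.$$
   Context: Fix $d\ge1$ and a norm $\|\cdot\|$ on $\mathbb R^d$. A discretized curve is a family $\mathbf p=(\mathbf p_0,\dots,\mathbf p_{n-1})\in\mathbb R^{n\times d}$ of points of $\mathbb R^d$, with indices read modulo $n$: $\mathbf p_i=\mathbf p_{i \bmod n}$ for $i\in\mathbb Z$. The renormalized norm is $\|\mathbf p\|_{\ell^q}=\big(\frac1n\sum_{i=0}^{n-1}\|\mathbf p_i\|^q\big)^{1/q}$. The discrete derivative of order $r$ is $(\Delta^{\star r}\star\mathbf p)_i=\sum_{j=0}^r(-1)^j\binom rj\mathbf p_{i-j}$, i.e. the $r$-fold iterate of $\mathbf p\mapsto(\mathbf p_i-\mathbf p_{i-1})_i$. Periodic Sobolev multiball: $W^{m,q}_\sharp(\boldsymbol\alpha)$ is the set of $1$-periodic functions $f:[0,1]\to\mathbb R^d$ in $L^1$ whose (periodic, weak) derivatives satisfy $\|f^{(r)}\|_{L^q([0,1])}\le\boldsymbol\alpha_r$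 for all $0\le r\le m$. Discrete periodic multiball: $\mathcal P^{m,q}_{\sharp,n}(\boldsymbol\alpha)=\{\mathbf p\in\mathbb R^{n\times d}: n^r\|\Delta^{\star r}\star\mathbf p\|_{\ell^q}\le\boldsymbol\alpha_r \text{ for all } 0\le r\le m\}$. Zero-order spline: $s^0(\mathbf p):[0,1]\to\mathbb R^d$, $s^0(\mathbf p)(t)=\mathbf p_{\lfloor nt\rfloor}$, and $\mathcal S^{m,q}_{\sharp,n}(\boldsymbol\alpha)=\{s^0(\mathbf p):\mathbf p\in\mathcal P^{m,q}_{\sharp,n}(\boldsymbol\alpha)\}$. Distance between curves: $d(f,g)=\int_0^1\|f(t)-g(t)\|\,dt$. Hausdorff distance between two sets of curves: $d_{\mathcal H}(A,B)=\sup_{f\in A}\inf_{g\in B}d(f,g)+\sup_{g\in B}\inf_{f\in A}d(f,g)$. *)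

theory Defs
  imports "HOL-Analysis.Analysis"
begin

text \<open>
  The constant in the theorem is uniform in the dimension \<open>d\<close>, so \<open>d\<close> must be a term and
  cannot be a type: \<open>\<real>\<^sup>d\<close> is the set of real sequences vanishing from index \<open>d\<close> on, and a
  norm on it is a real-valued function that is only constrained, and only ever applied, on
  that set.
\<close>

type_synonym vect = "nat \<Rightarrow> real"

definition Rd :: "nat \<Rightarrow> vect set" where
  "Rd d = {x. \<forall>k\<ge>d. x k = 0}"

definition norm_on_Rd :: "nat \<Rightarrow> (vect \<Rightarrow> real) \<Rightarrow> bool" where
  "norm_on_Rd d N \<longleftrightarrow>
     (\<forall>x\<in>Rd d. 0 \<le> N x \<and> (N x = 0 \<longleftrightarrow> x = (\<lambda>k. 0))) \<and>
     (\<forall>c. \<forall>x\<in>Rd d. N (\<lambda>k. c * x k) = \<bar>c\<bar> * N x) \<and>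
     (\<forall>x\<in>Rd d. \<forall>y\<in>Rd d. N (\<lambda>k. x k + y k) \<le> N x + N y)"

text \<open>
  A discretized curve with \<open>n\<close> points is a function \<open>p :: nat \<Rightarrow> vect\<close> of which only the
  values at \<open>0, \<dots>, n - 1\<close> are used.
\<close>

definition cyclic_nth :: "nat \<Rightarrow> (nat \<Rightarrow> vect) \<Rightarrow> int \<Rightarrow> vect" where
  "cyclic_nth n p i = p (nat (i mod int n))"

definition lq_norm :: "(vect \<Rightarrow> real) \<Rightarrow> real \<Rightarrow> nat \<Rightarrow> (nat \<Rightarrow> vect) \<Rightarrow> real" where
  "lq_norm N q n p = ((1 / real n) * (\<Sum>i<n. N (p i) powr q)) powr (1 / q)"

definition discrete_deriv :: "nat \<Rightarrow> nat \<Rightarrow> (nat \<Rightarrow> vect) \<Rightarrow> nat \<Rightarrow> vect" where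
  "discrete_deriv n r p i =
     (\<lambda>k. \<Sum>j=0..r. (-1) ^ j * real (r choose j) * cyclic_nth n p (int i - int j) k)"

definition discrete_multiball ::
    "nat \<Rightarrow> (vect \<Rightarrow> real) \<Rightarrow> nat \<Rightarrow> real \<Rightarrow> nat \<Rightarrow> (nat \<Rightarrow> real) \<Rightarrow> (nat \<Rightarrow> vect) set" where
  "discrete_multiball d N m q n \<alpha> =
     {p. (\<forall>i<n. p i \<in> Rd d) \<and>
         (\<forall>r\<le>m. real n ^ r * lq_norm N q n (discrete_deriv n r p) \<le> \<alpha> r)}"

text \<open>
  Curves on \<open>[0,1]\<close> are represented by their 1-periodic extensions to the real line; every
  integral is over \<open>[0,1]\<close>.
\<close>

definition zero_order_spline :: "nat \<Rightarrow> (nat \<Rightarrow> vect) \<Rightarrow> real \<Rightarrow> vect" where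
  "zero_order_spline n p t = cyclic_nth n p \<lfloor>real n * t\<rfloor>"

definition spline_multiball ::
    "nat \<Rightarrow> (vect \<Rightarrow> real) \<Rightarrow> nat \<Rightarrow> real \<Rightarrow> nat \<Rightarrow> (nat \<Rightarrow> real) \<Rightarrow> (real \<Rightarrow> vect) set" where
  "spline_multiball d N m q n \<alpha> = zero_order_spline n ` discrete_multiball d N m q n \<alpha>"

definition periodic_L1 :: "nat \<Rightarrow> (real \<Rightarrow> vect) set" where
  "periodic_L1 d =
     {f. (\<forall>t. f t \<in> Rd d) \<and> (\<forall>t. f (t + 1) = f t) \<and>
         (\<forall>k<d. integrable (lebesgue_on {0..1}) (\<lambda>t. f t k))}"

definition smooth_periodic :: "(real \<Rightarrow> real) \<Rightarrow> bool" where
  "smooth_periodic \<phi> \<longleftrightarrow>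
     (\<forall>t. \<phi> (t + 1) = \<phi> t) \<and> (\<forall>r t. (deriv ^^ r) \<phi> field_differentiable (at t))"

text \<open>
  Test functions are periodic rather than compactly supported in \<open>(0,1)\<close>, so a jump of \<open>f\<close>
  across the endpoints is seen by the weak derivative.
\<close>

definition periodic_weak_deriv ::
    "nat \<Rightarrow> nat \<Rightarrow> (real \<Rightarrow> vect) \<Rightarrow> (real \<Rightarrow> vect) \<Rightarrow> bool" where
  "periodic_weak_deriv d r f g \<longleftrightarrow>
     (\<forall>\<phi>. smooth_periodic \<phi> \<longrightarrow>
       (\<forall>k<d. (LINT t|lebesgue_on {0..1}. g t k * \<phi> t) =
              (-1) ^ r * (LINT t|lebesgue_on {0..1}. f t k * (deriv ^^ r) \<phi> t)))"

text \<open>Integrability is required explicitly because the integral of a non-integrable function is 0.\<close>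

definition Lq_norm_le :: "(vect \<Rightarrow> real) \<Rightarrow> real \<Rightarrow> (real \<Rightarrow> vect) \<Rightarrow> real \<Rightarrow> bool" where
  "Lq_norm_le N q g c \<longleftrightarrow>
     integrable (lebesgue_on {0..1}) (\<lambda>t. N (g t) powr q) \<and>
     (LINT t|lebesgue_on {0..1}. N (g t) powr q) powr (1 / q) \<le> c"

definition sobolev_multiball ::
    "nat \<Rightarrow> (vect \<Rightarrow> real) \<Rightarrow> nat \<Rightarrow> real \<Rightarrow> (nat \<Rightarrow> real) \<Rightarrow> (real \<Rightarrow> vect) set" where
  "sobolev_multiball d N m q \<alpha> =
     {f \<in> periodic_L1 d.
        \<forall>r\<le>m. \<exists>g\<in>periodic_L1 d. periodic_weak_deriv d r f g \<and> Lq_norm_le N q g (\<alpha> r)}"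

text \<open>Distances are extended nonnegative reals, so that suprema and infima are the true ones.\<close>

definition curve_dist :: "(vect \<Rightarrow> real) \<Rightarrow> (real \<Rightarrow> vect) \<Rightarrow> (real \<Rightarrow> vect) \<Rightarrow> ennreal" where
  "curve_dist N f g = (\<integral>\<^sup>+ t. ennreal (N (\<lambda>k. f t k - g t k)) \<partial>lebesgue_on {0..1})"

definition curve_hausdorff ::
    "(vect \<Rightarrow> real) \<Rightarrow> (real \<Rightarrow> vect) set \<Rightarrow> (real \<Rightarrow> vect) set \<Rightarrow> ennreal" where
  "curve_hausdorff N A B =
     (SUP f\<in>A. INF g\<in>B. curve_dist N f g) + (SUP g\<in>B. INF f\<in>A. curve_dist N f g)"

end

theory Submission
  imports Defs
begin

text \<open>
  Let \<open>A f\<close> be the average of \<open>f\<close> over the window of length \<open>1/n\<close> to the left of a point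
  (\<open>steklov\<close>), and \<open>D f (t) = n (f t - f (t - 1/n))\<close> (\<open>bdiff\<close>). On periodic functions \<open>A\<close> and
  \<open>D\<close> commute, \<open>D f = A f'\<close>, and by Jensen's inequality \<open>A\<close> does not increase any of the
  norms, so both multiballs can be mapped exactly into each other.

  From a Sobolev curve \<open>f\<close> take the cell averages \<open>p\<^sub>i = A f ((i + 1)/n)\<close>: their rescaled
  \<open>r\<close>-th differences are the values of \<open>A ^ (r + 1) (f\<^sup>(\<^sup>r\<^sup>))\<close>, and the spline of \<open>p\<close> differs
  from \<open>f\<close> by at most the integral of the norm of \<open>f'\<close> over a neighbourhood of size \<open>1/n\<close>.
  From a spline \<open>s\<close> take \<open>A ^ m s\<close>: its \<open>r\<close>-th weak derivative is \<open>A ^ (m - r) (D ^ r s)\<close>, and its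
  distance to \<open>s\<close> is controlled by \<open>m\<close> jumps of \<open>s\<close>. This gives \<open>\<kappa> = (m + 2) \<alpha>\<^sub>1\<close>.
\<close>

section \<open>Norms on \<open>\<real>\<^sup>d\<close> and supporting functionals\<close>

text \<open>The obstacle is that all \<open>m + 1\<close> bounds must hold with the same
  \<open>\<alpha>\<close> on both sides: a construction that meets them only up to a factor
  \<open>1 + O(1/n)\<close> would need a further rescaling. Averaging avoids this because it is
  linear, translation invariant, fixes constants and is contractive in the sense of Jensen, so every
  order is bounded at once. Each average turns one difference quotient into one weak derivative,
  since \<open>(A f)' = D f\<close>; this is why \<open>m\<close> averages are applied to a spline.
  The norm is arbitrary, so Jensen's inequality is derived from affine minorants of
  \<open>N x powr q\<close>, obtained by a finite-dimensional Hahn-Banach argument. Everything else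
  is then done coordinate by coordinate with scalar functions. A weak derivative is only determined
  up to null sets, whereas \<open>D f = A f'\<close> is a pointwise identity; a periodic du
  Bois-Reymond lemma supplies the primitive for which it holds. Only \<alpha> at index 1 enters the
  constant: both distances are integrals of a first difference or derivative, and on a unit interval
  the L1 mean is at most the Lq mean. The summand \<open>m\<close> counts jumps, the summand 2
  counts cells in a window around a point.\<close>

lemma Rd_mono: "j \<le> d \<Longrightarrow> Rd j \<subseteq> Rd d"
  by (auto simp: Rd_def)

lemma Rd_zero: "(\<lambda>k. 0) \<in> Rd d"
  and Rd_add: "x \<in> Rd d \<Longrightarrow> y \<in> Rd d \<Longrightarrow> (\<lambda>k. x k + y k) \<in> Rd d"
  and Rd_diff: "x \<in> Rd d \<Longrightarrow> y \<in> Rd d \<Longrightarrow> (\<lambda>k. x k - y k) \<in> Rd d"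
  and Rd_scale: "x \<in> Rd d \<Longrightarrow> (\<lambda>k. c * x k) \<in> Rd d"
  by (auto simp: Rd_def)

lemma Rd_unit: "j < d \<Longrightarrow> (\<lambda>k. of_bool (k = j)) \<in> Rd d"
  by (auto simp: Rd_def)

context
  fixes d :: nat and N :: "vect \<Rightarrow> real"
  assumes N: "norm_on_Rd d N"
begin

lemma N_nonneg: "x \<in> Rd d \<Longrightarrow> 0 \<le> N x"
  and N_zero: "N (\<lambda>k. 0) = 0"
  and N_scale: "x \<in> Rd d \<Longrightarrow> N (\<lambda>k. c * x k) = \<bar>c\<bar> * N x"
  and N_triangle: "x \<in> Rd d \<Longrightarrow> y \<in> Rd d \<Longrightarrow> N (\<lambda>k. x k + y k) \<le> N x + N y"
  using N Rd_zero[of d] by (auto simp: norm_on_Rd_def)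

lemma N_minus_commute:
  assumes "x \<in> Rd d" "y \<in> Rd d"
  shows "N (\<lambda>k. x k - y k) = N (\<lambda>k. y k - x k)"
  using N_scale[OF Rd_diff[OF assms], of "-1"] by simp

lemma N_triangle_diff:
  assumes "x \<in> Rd d" "y \<in> Rd d" "z \<in> Rd d"
  shows "N (\<lambda>k. x k - z k) \<le> N (\<lambda>k. x k - y k) + N (\<lambda>k. y k - z k)"
  using N_triangle[OF Rd_diff[OF assms(1,2)] Rd_diff[OF assms(2,3)]] by simp

text \<open>Hahn-Banach, one coordinate at a time. The vector \<open>x\<close> is carried as a
  formal extra generator with prescribed value \<open>N x\<close>, even though it also lies in the
  span of the coordinates; domination by \<open>N\<close> later forces the two descriptions to
  agree.\<close>

lemma dominated_functional_extend:
  assumes x: "x \<in> Rd d" and "j \<le> d"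
  shows "\<exists>c. \<forall>a. \<forall>y\<in>Rd j. a * N x + (\<Sum>k<j. c k * y k) \<le> N (\<lambda>k. a * x k + y k)"
  using \<open>j \<le> d\<close>
proof (induction j)
  case 0
  have "a * N x \<le> N (\<lambda>k. a * x k)" for a
    using N_nonneg[OF x] by (simp add: N_scale[OF x] mult_right_mono)
  then have "a * N x \<le> N (\<lambda>k. a * x k + y k)" if "y \<in> Rd 0" for a y
    using that by (simp add: Rd_def)
  then show ?case by simp
next
  case (Suc j)
  then obtain c where c: "\<And>a y. y \<in> Rd j \<Longrightarrow> a * N x + (\<Sum>k<j. c k * y k) \<le> N (\<lambda>k. a * x k + y k)"
    by force
  define e :: vect where "e = (\<lambda>k. of_bool (k = j))"
  have e: "e \<in> Rd d"
    using Rd_unit[of j d] Suc.prems by (simp add: e_def)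
  have sub: "Rd j \<subseteq> Rd d"
    using Suc.prems by (intro Rd_mono) simp
  have inRd: "(\<lambda>k. a * x k + y k) \<in> Rd d" if "y \<in> Rd j" for a y
    using that sub x Rd_add Rd_scale by blast
  \<comment> \<open>Every lower bound for the value on the new unit vector \<open>e\<close> lies
    below every upper bound: the two copies of \<open>e\<close> cancel in the triangle inequality.
    Hence the supremum \<open>s\<close> of the lower bounds is an admissible value.\<close>
  have key: "a * N x + (\<Sum>k<j. c k * y k) - N (\<lambda>k. a * x k + y k - e k)
      \<le> N (\<lambda>k. b * x k + z k + e k) - b * N x - (\<Sum>k<j. c k * z k)"
    if y: "y \<in> Rd j" and z: "z \<in> Rd j" for a b y z
  proof -
    have "(a + b) * N x + (\<Sum>k<j. c k * (y k + z k)) \<le> N (\<lambda>k. (a + b) * x k + (y k + z k))"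
      using c Rd_add[OF y z] by blast
    also have "\<dots> = N (\<lambda>k. (a * x k + y k - e k) + (b * x k + z k + e k))"
      by (simp add: algebra_simps)
    also have "\<dots> \<le> N (\<lambda>k. a * x k + y k - e k) + N (\<lambda>k. b * x k + z k + e k)"
      using N_triangle Rd_diff[OF inRd[OF y] e] Rd_add[OF inRd[OF z] e] by blast
    finally show ?thesis
      by (simp add: algebra_simps sum.distrib)
  qed
  define L where "L = (\<lambda>(a, y). a * N x + (\<Sum>k<j. c k * y k) - N (\<lambda>k. a * x k + y k - e k))"
  define s where "s = Sup (L ` (UNIV \<times> Rd j))"
  have bdd: "bdd_above (L ` (UNIV \<times> Rd j))"
    using key[OF _ Rd_zero] by (intro bdd_aboveI) (auto simp: L_def)
  have s_ge: "a * N x + (\<Sum>k<j. c k * y k) - N (\<lambda>k. a * x k + y k - e k) \<le> s"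
    if "y \<in> Rd j" for a y
  proof -
    have "L (a, y) \<le> s"
      unfolding s_def using that by (intro cSup_upper bdd imageI) simp
    then show ?thesis by (simp add: L_def)
  qed
  have s_le: "s \<le> N (\<lambda>k. b * x k + z k + e k) - b * N x - (\<Sum>k<j. c k * z k)"
    if "z \<in> Rd j" for b z
    unfolding s_def using key[OF _ that] Rd_zero[of j]
    by (intro cSup_least) (auto simp: L_def)
  show ?case
  proof (intro exI allI ballI)
    fix a y assume y: "y \<in> Rd (Suc j)"
    define z where "z = (\<lambda>k. if k = j then 0 else y k)"
    have z: "z \<in> Rd j"
      using y by (auto simp: z_def Rd_def)
    have sum: "(\<Sum>k<Suc j. (c(j := s)) k * y k) = (\<Sum>k<j. c k * z k) + s * y j"
      by (simp add: z_def)
    have split: "(\<lambda>k. a * x k + y k) = (\<lambda>k. a * x k + z k + y j * e k)"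
      by (auto simp: z_def e_def)
    \<comment> \<open>By homogeneity, dividing by the absolute value of \<open>y j\<close> reduces
      to coefficient 1 or -1 of \<open>e\<close>, which are the upper and the lower bound on
      \<open>s\<close>.\<close>
    consider "y j = 0" | "y j > 0" | "y j < 0" by linarith
    then show "a * N x + (\<Sum>k<Suc j. (c(j := s)) k * y k) \<le> N (\<lambda>k. a * x k + y k)"
    proof cases
      case 1
      then show ?thesis using c[OF z] by (simp only: sum split) simp
    next
      case 2
      define w where "w = (\<lambda>k. (1 / y j) * z k)"
      have w: "w \<in> Rd j" unfolding w_def by (rule Rd_scale[OF z])
      have "y j * s \<le> y j * (N (\<lambda>k. (a / y j) * x k + w k + e k) - (a / y j) * N x - (\<Sum>k<j. c k * w k))"
        using s_le[OF w, of "a / y j"] 2 by (intro mult_left_mono) auto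
      also have "\<dots> = y j * N (\<lambda>k. (a / y j) * x k + w k + e k) - a * N x - (\<Sum>k<j. c k * z k)"
        using 2 by (simp add: right_diff_distrib sum_distrib_left w_def)
      also have "y j * N (\<lambda>k. (a / y j) * x k + w k + e k) =
          N (\<lambda>k. y j * ((a / y j) * x k + w k + e k))"
        using N_scale[OF Rd_add[OF inRd[OF w, of "a / y j"] e], where c = "y j"] 2 by simp
      also have "(\<lambda>k. y j * ((a / y j) * x k + w k + e k)) = (\<lambda>k. a * x k + z k + y j * e k)"
        using 2 by (auto simp: w_def field_simps)
      finally show ?thesis unfolding sum split by (simp add: algebra_simps)
    next
      case 3
      define u where "u = - y j"
      have u: "u > 0" using 3 by (simp add: u_def)
      define w where "w = (\<lambda>k. (1 / u) * z k)"
      have w: "w \<in> Rd j" unfolding w_def by (rule Rd_scale[OF z])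
      have "u * ((a / u) * N x + (\<Sum>k<j. c k * w k) - N (\<lambda>k. (a / u) * x k + w k - e k)) \<le> u * s"
        using s_ge[OF w, of "a / u"] u by (intro mult_left_mono) auto
      moreover have "u * ((a / u) * N x + (\<Sum>k<j. c k * w k) - N (\<lambda>k. (a / u) * x k + w k - e k))
          = a * N x + (\<Sum>k<j. c k * z k) - u * N (\<lambda>k. (a / u) * x k + w k - e k)"
        using u by (simp add: algebra_simps sum_distrib_left w_def)
      moreover have "u * N (\<lambda>k. (a / u) * x k + w k - e k) =
          N (\<lambda>k. u * ((a / u) * x k + w k - e k))"
        using N_scale[OF Rd_diff[OF inRd[OF w, of "a / u"] e], where c = "u"] u by simp
      moreover have "(\<lambda>k. u * ((a / u) * x k + w k - e k)) = (\<lambda>k. a * x k + z k + y j * e k)"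
        using u by (auto simp: w_def u_def field_simps)
      ultimately show ?thesis unfolding sum split by (simp add: u_def algebra_simps)
    qed
  qed
qed

text \<open>In the extension, \<open>a = 0\<close> gives domination by \<open>N\<close>, and
  \<open>a = 1\<close> with \<open>y = -x\<close> gives the missing inequality at
  \<open>x\<close>.\<close>

lemma norming_functional:
  assumes x: "x \<in> Rd d"
  obtains c where "N x = (\<Sum>k<d. c k * x k)" "\<And>y. y \<in> Rd d \<Longrightarrow> (\<Sum>k<d. c k * y k) \<le> N y"
proof -
  obtain c where c: "\<And>a y. y \<in> Rd d \<Longrightarrow> a * N x + (\<Sum>k<d. c k * y k) \<le> N (\<lambda>k. a * x k + y k)"
    using dominated_functional_extend[OF x order.refl] by blast
  have le: "(\<Sum>k<d. c k * y k) \<le> N y" if "y \<in> Rd d" for y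
    using c[OF that, of 0] by simp
  have "(\<lambda>k. - x k) \<in> Rd d"
    using Rd_scale[OF x, of "-1"] by simp
  from c[OF this, of 1] have "N x \<le> (\<Sum>k<d. c k * x k)"
    by (simp add: N_zero sum_negf)
  with le[OF x] have "N x = (\<Sum>k<d. c k * x k)" by linarith
  from this le show ?thesis by (rule that)
qed

end

section \<open>Convexity of the power of a norm, and measurability of norms\<close>

lemma powr_above_tangent:
  fixes a y q :: real
  assumes "q \<ge> 1" "a > 0" "y \<ge> 0"
  shows "a powr q + q * a powr (q - 1) * (y - a) \<le> y powr q"
\<comment> \<open>The tangent rule is applied on the open half-line; the boundary point is checked
  by hand, where the claim reduces to \<open>1 - q \<le> 0\<close>.\<close>
proof (cases "y = 0")
  case True
  have "a powr (q - 1) * a = a powr q"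
    using assms by (simp add: powr_diff)
  moreover have "a powr q * (1 - q) \<le> 0"
    using assms by (simp add: mult_nonneg_nonpos)
  ultimately show ?thesis
    using assms True by (simp add: algebra_simps)
next
  case False
  have "q * a powr (q - 1) * (y - a) \<le> y powr q - a powr q"
  proof (rule convex_on_imp_above_tangent)
    show "convex_on {0<..} (\<lambda>x. x powr q)" using assms by (intro powr_convex)
    show "((\<lambda>x. x powr q) has_real_derivative q * a powr (q - 1)) (at a within {0<..})"
      using assms by (auto intro!: derivative_eq_intros simp: powr_diff)
    show "connected {0::real<..}" by simp
    show "a \<in> interior {0<..}" using assms by (simp add: interior_open)
    show "y \<in> {0<..}" using False assms by simp
  qed
  then show ?thesis by simp
qed

context
  fixes d :: nat and N :: "vect \<Rightarrow> real"
  assumes N: "norm_on_Rd d N"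
begin

text \<open>The tangent of \<open>y powr q\<close> at \<open>N x\<close>, composed with a norming
  functional of \<open>x\<close>; its slope is nonnegative, so the bound of the functional by
  \<open>N y\<close> can be inserted. This is the source of all uses of Jensen's inequality.\<close>

lemma norm_powr_supporting_affine:
  assumes x: "x \<in> Rd d" and q: "q \<ge> (1::real)"
  obtains c0 c where "N x powr q = c0 + (\<Sum>k<d. c k * x k)"
    "\<And>y. y \<in> Rd d \<Longrightarrow> c0 + (\<Sum>k<d. c k * y k) \<le> N y powr q"
proof (cases "N x = 0")
  case True
  then show ?thesis by (intro that[of 0 "\<lambda>_. 0"]) auto
next
  case False
  then have pos: "N x > 0" using N_nonneg[OF N x] by linarith
  obtain c where c: "N x = (\<Sum>k<d. c k * x k)" "\<And>y. y \<in> Rd d \<Longrightarrow> (\<Sum>k<d. c k * y k) \<le> N y"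
    using norming_functional[OF N x] by metis
  define b where "b = q * N x powr (q - 1)"
  have b: "b \<ge> 0" using q by (simp add: b_def)
  show ?thesis
  proof (rule that)
    show "N x powr q = (N x powr q - b * N x) + (\<Sum>k<d. b * c k * x k)"
      by (simp add: c(1) sum_distrib_left mult.assoc)
    fix y assume y: "y \<in> Rd d"
    have "(\<Sum>k<d. b * c k * y k) \<le> b * N y"
      using mult_left_mono[OF c(2)[OF y] b] by (simp add: sum_distrib_left mult.assoc)
    then have "(N x powr q - b * N x) + (\<Sum>k<d. b * c k * y k) \<le> N x powr q + b * (N y - N x)"
      by (simp add: algebra_simps)
    also have "\<dots> \<le> N y powr q"
      using powr_above_tangent[OF q pos N_nonneg[OF N y]] by (simp add: b_def)
    finally show "(N x powr q - b * N x) + (\<Sum>k<d. b * c k * y k) \<le> N y powr q" .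
  qed
qed

lemma norm_le_sum_coordinates:
  assumes "j \<le> d" "y \<in> Rd j"
  shows "N y \<le> (\<Sum>k<j. \<bar>y k\<bar> * N (\<lambda>i. of_bool (i = k)))"
  using assms
proof (induction j arbitrary: y)
  case 0
  then have "y = (\<lambda>k. 0)" by (auto simp: Rd_def)
  then show ?case using N_zero[OF N] by simp
next
  case (Suc j)
  define z where "z = (\<lambda>k. if k = j then 0 else y k)"
  define e :: vect where "e = (\<lambda>k. of_bool (k = j))"
  have z: "z \<in> Rd j" using Suc.prems by (auto simp: z_def Rd_def)
  have e: "e \<in> Rd d" using Rd_unit[of j d] Suc.prems by (simp add: e_def)
  have zd: "z \<in> Rd d" using z Rd_mono[of j d] Suc.prems by auto
  have "y = (\<lambda>k. z k + y j * e k)" by (auto simp: z_def e_def)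
  then have "N y \<le> N z + N (\<lambda>k. y j * e k)"
    using N_triangle[OF N zd Rd_scale[OF e]] by metis
  also have "N (\<lambda>k. y j * e k) = \<bar>y j\<bar> * N e" by (rule N_scale[OF N e])
  also have "N z \<le> (\<Sum>k<j. \<bar>z k\<bar> * N (\<lambda>i. of_bool (i = k)))"
    using Suc.IH[OF _ z] Suc.prems by simp
  finally show ?case by (simp add: z_def e_def)
qed

lemma norm_comp_measurable:
  assumes f: "\<And>t. f t \<in> Rd d" and meas: "\<And>k. k < d \<Longrightarrow> (\<lambda>t. f t k) \<in> borel_measurable M"
  shows "(\<lambda>t. N (f t)) \<in> borel_measurable M"
proof -
  \<comment> \<open>\<open>N\<close> is constrained only on \<open>Rd d\<close>. Truncation first
    gives a function on all sequences, continuous for the product topology because it depends on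
    finitely many coordinates in a Lipschitz way.\<close>
  define P :: "vect \<Rightarrow> vect" where "P = (\<lambda>x k. if k < d then x k else 0)"
  have P: "P x \<in> Rd d" for x by (auto simp: P_def Rd_def)
  have dist: "\<bar>N (P x) - N (P y)\<bar> \<le> (\<Sum>k<d. \<bar>x k - y k\<bar> * N (\<lambda>i. of_bool (i = k)))" for x y
  proof -
    have "N (P x) \<le> N (\<lambda>k. P x k - P y k) + N (P y)"
      using N_triangle[OF N Rd_diff[OF P P] P, of x y y] by simp
    moreover have "N (P y) \<le> N (\<lambda>k. P x k - P y k) + N (P x)"
      using N_triangle[OF N Rd_diff[OF P P] P, of y x x] N_minus_commute[OF N P P, of x y] by simp
    moreover have "N (\<lambda>k. P x k - P y k) \<le> (\<Sum>k<d. \<bar>P x k - P y k\<bar> * N (\<lambda>i. of_bool (i = k)))"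
      by (rule norm_le_sum_coordinates[OF order.refl Rd_diff[OF P P]])
    moreover have "(\<Sum>k<d. \<bar>P x k - P y k\<bar> * N (\<lambda>i. of_bool (i = k))) =
        (\<Sum>k<d. \<bar>x k - y k\<bar> * N (\<lambda>i. of_bool (i = k)))"
      by (intro sum.cong) (auto simp: P_def)
    ultimately show ?thesis by linarith
  qed
  have "isCont (\<lambda>x. N (P x)) y" for y
  proof -
    have "((\<lambda>x. \<Sum>k<d. \<bar>x k - y k\<bar> * N (\<lambda>i. of_bool (i = k))) \<longlongrightarrow> (\<Sum>k<d. \<bar>y k - y k\<bar> * N (\<lambda>i. of_bool (i = k)))) (at y)"
      by (intro tendsto_intros tendsto_rabs)
         (metis continuous_on_product_coordinates continuous_on_eq_continuous_at isCont_def open_UNIV UNIV_I)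
    then have "((\<lambda>x. \<Sum>k<d. \<bar>x k - y k\<bar> * N (\<lambda>i. of_bool (i = k))) \<longlongrightarrow> 0) (at y)" by simp
    then have "((\<lambda>x. N (P x) - N (P y)) \<longlongrightarrow> 0) (at y)"
      by (rule Lim_null_comparison[rotated]) (use dist in auto)
    then show ?thesis unfolding isCont_def by (rule LIM_zero_cancel)
  qed
  then have "(\<lambda>x. N (P x)) \<in> borel_measurable borel"
    by (intro borel_measurable_continuous_onI continuous_at_imp_continuous_on) auto
  moreover have "f \<in> borel_measurable M"
  proof (rule measurable_coordinatewise_then_product)
    fix k
    have "(\<lambda>t. f t k) = (\<lambda>t. 0)" if "\<not> k < d" using f that by (auto simp: Rd_def)
    then show "(\<lambda>t. f t k) \<in> borel_measurable M" using meas by (cases "k < d") auto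
  qed
  ultimately have "(\<lambda>t. N (P (f t))) \<in> borel_measurable M"
    by (rule measurable_compose_rev)
  moreover have "P (f t) = f t" for t using f[of t] by (auto simp: P_def Rd_def)
  ultimately show ?thesis by simp
qed

end

section \<open>Periodic functions and Steklov averages\<close>

text \<open>Integrability is asked on every interval, so that translates and windows that cross an
  integer stay within the class.\<close>

definition periodic_integrable :: "(real \<Rightarrow> real) \<Rightarrow> bool" where
  "periodic_integrable f \<longleftrightarrow> (\<forall>t. f (t + 1) = f t) \<and> (\<forall>a b. f absolutely_integrable_on {a..b})"

lemma periodic_integrable_integrable_on [intro]:
  "periodic_integrable f \<Longrightarrow> f integrable_on {a..b}"
  by (auto simp: periodic_integrable_def absolutely_integrable_on_def)

lemma integral_shift:
  fixes f :: "real \<Rightarrow> real"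
  shows "integral {a..b} (\<lambda>t. f (t + c)) = integral {a + c..b + c} f"
  using integral_shift_Icc_real[of a b f c] by (simp add: o_def add.commute)

lemma absolutely_integrable_shift:
  fixes f :: "real \<Rightarrow> real"
  assumes "f absolutely_integrable_on {a + c..b + c}"
  shows "(\<lambda>t. f (t + c)) absolutely_integrable_on {a..b}"
proof -
  have "(g \<circ> (+) c) integrable_on {a..b}" if "g integrable_on {a + c..b + c}" for g :: "real \<Rightarrow> real"
    using that has_integral_shift_Icc_real[of g c _ a b] by (auto simp: integrable_on_def)
  from this[of f] this[of "\<lambda>t. norm (f t)"] assms show ?thesis
    by (auto simp: absolutely_integrable_on_def o_def add.commute)
qed

lemma periodic_integrable_shift:
  assumes "periodic_integrable f"
  shows "periodic_integrable (\<lambda>t. f (t + c))"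
  unfolding periodic_integrable_def
proof (intro conjI allI)
  show "f (t + 1 + c) = f (t + c)" for t
    using assms by (metis periodic_integrable_def add.commute add.left_commute)
  show "(\<lambda>t. f (t + c)) absolutely_integrable_on {a..b}" for a b
    using assms by (intro absolutely_integrable_shift) (auto simp: periodic_integrable_def)
qed

lemma periodic_add_int:
  fixes f :: "real \<Rightarrow> 'a"
  assumes "\<And>t. f (t + 1) = f t"
  shows "f (t + of_int i) = f t"
proof (induction i rule: int_induct[of _ 0])
  case (step1 i)
  then show ?case using assms[of "t + of_int i"] by (simp add: add_ac)
next
  case (step2 i)
  then show ?case using assms[of "t + of_int (i - 1)"] by (simp add: add.assoc)
qed simp

lemma periodic_integrable_add:
  "periodic_integrable f \<Longrightarrow> periodic_integrable g \<Longrightarrow> periodic_integrable (\<lambda>t. f t + g t)"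
  and periodic_integrable_diff:
  "periodic_integrable f \<Longrightarrow> periodic_integrable g \<Longrightarrow> periodic_integrable (\<lambda>t. f t - g t)"
  and periodic_integrable_cmult:
  "periodic_integrable f \<Longrightarrow> periodic_integrable (\<lambda>t. c * f t)"
  by (auto simp: periodic_integrable_def)

lemma periodic_integrable_const: "periodic_integrable (\<lambda>t. c)"
  by (auto simp: periodic_integrable_def intro!: absolutely_integrable_continuous_real)

lemma periodic_integrable_sum:
  "finite I \<Longrightarrow> (\<And>i. i \<in> I \<Longrightarrow> periodic_integrable (f i)) \<Longrightarrow> periodic_integrable (\<lambda>t. \<Sum>i\<in>I. f i t)"
  by (induction I rule: finite_induct) (auto intro: periodic_integrable_add periodic_integrable_const)

lemma periodic_integral_combine:
  "periodic_integrable f \<Longrightarrow> a \<le> c \<Longrightarrow> c \<le> b \<Longrightarrow>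
    integral {a..c} f + integral {c..b} f = integral {a..b} f"
  by (rule Henstock_Kurzweil_Integration.integral_combine) auto

lemma integral_over_period:
  assumes f: "periodic_integrable f"
  shows "integral {a..a + 1} f = integral {0..1} f"
proof -
  define r where "r = a - of_int \<lfloor>a\<rfloor>"
  have r: "0 \<le> r" "r \<le> 1" unfolding r_def by linarith+
  have per: "f (t + of_int i) = f t" for t i
    using f by (intro periodic_add_int) (auto simp: periodic_integrable_def)
  have "integral {a..a + 1} f = integral {r..r + 1} (\<lambda>t. f (t + of_int \<lfloor>a\<rfloor>))"
    by (simp add: integral_shift r_def algebra_simps)
  also have "\<dots> = integral {r..r + 1} f" by (simp add: per)
  also have "\<dots> = integral {r..1} f + integral {1..r + 1} f"
    using r by (intro periodic_integral_combine[symmetric] f) auto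
  also have "integral {1..r + 1} f = integral {0..r} (\<lambda>t. f (t + of_int 1))"
    by (simp add: integral_shift add.commute)
  also have "\<dots> = integral {0..r} f" by (simp only: per)
  also have "integral {r..1} f + integral {0..r} f = integral {0..1} f"
    using periodic_integral_combine[OF f r] by simp
  finally show ?thesis .
qed

lemma integral_period_shift:
  assumes f: "periodic_integrable f"
  shows "integral {0..1} (\<lambda>t. f (t + c)) = integral {0..1} f"
  using integral_over_period[OF f, of c] by (simp add: integral_shift add.commute)

lemma periodic_integrableI:
  assumes per: "\<And>t. f (t + 1) = f t" and int: "f absolutely_integrable_on {0..1}"
  shows "periodic_integrable f"
proof -
  have unit: "f absolutely_integrable_on {of_int i..of_int i + 1}" for i
  proof -
    have "(\<lambda>t. f (t + of_int (- i))) absolutely_integrable_on {of_int i..of_int i + 1}"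
      using int by (intro absolutely_integrable_shift) simp
    then show ?thesis by (simp only: periodic_add_int[of f, OF per])
  qed
  have nat: "f absolutely_integrable_on {of_int i..of_int i + real m}" for i m
  proof (induction m)
    case 0
    then show ?case using absolutely_integrable_on_subinterval[OF unit[of i], of "of_int i" "of_int i"] by simp
  next
    case (Suc m)
    have "f absolutely_integrable_on {of_int i + real m..of_int i + real (Suc m)}"
      using unit[of "i + int m"] by (simp add: algebra_simps)
    from absolutely_integrable_on_combine[OF Suc this] show ?case by simp
  qed
  have "f absolutely_integrable_on {a..b}" for a b
  proof (rule absolutely_integrable_on_subinterval[OF nat[of "\<lfloor>a\<rfloor>" "nat \<lceil>b - of_int \<lfloor>a\<rfloor>\<rceil>"]])
    have "b - of_int \<lfloor>a\<rfloor> \<le> real (nat \<lceil>b - of_int \<lfloor>a\<rfloor>\<rceil>)" by (rule real_nat_ceiling_ge)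
    then show "{a..b} \<subseteq> {of_int \<lfloor>a\<rfloor>..of_int \<lfloor>a\<rfloor> + real (nat \<lceil>b - of_int \<lfloor>a\<rfloor>\<rceil>)}"
      by (auto intro: order_trans[of _ a])
  qed
  with per show ?thesis by (simp add: periodic_integrable_def)
qed

section \<open>Averages over windows of length \<open>1/n\<close> and backward difference
  quotients\<close>

definition steklov :: "nat \<Rightarrow> (real \<Rightarrow> real) \<Rightarrow> real \<Rightarrow> real" where
  "steklov n f x = real n * integral {x - 1 / real n..x} f"

text \<open>The factor \<open>n\<close> is built in, so that the \<open>r\<close>-fold iterate
  already contains the weight \<open>n ^ r\<close> of the discrete balls.\<close>

definition bdiff :: "nat \<Rightarrow> (real \<Rightarrow> real) \<Rightarrow> real \<Rightarrow> real" where
  "bdiff n f x = real n * (f x - f (x - 1 / real n))"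

lemma steklov_shift: "steklov n (\<lambda>t. f (t + c)) x = steklov n f (x + c)"
  by (simp add: steklov_def integral_shift algebra_simps)

lemma steklov_continuous:
  assumes f: "periodic_integrable f"
  shows "continuous_on {a..b} (steklov n f)"
proof -
  define h where "h = 1 / real n"
  have h: "h \<ge> 0" by (simp add: h_def)
  have eq: "steklov n f x = real n * (integral {a - h..x} f - integral {a - h..x - h} f)"
    if "x \<in> {a..b}" for x
    using periodic_integral_combine[OF f, of "a - h" "x - h" x] that h
    by (simp add: steklov_def h_def[symmetric])
  have "continuous_on {a..b} (\<lambda>x. integral {a - h..x} f)"
    by (rule continuous_on_subset[OF indefinite_integral_continuous_1[of f "a - h" b]]) (use f h in auto)
  moreover have "continuous_on {a..b} (\<lambda>x. integral {a - h..x - h} f)"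
    by (rule continuous_on_compose2[OF indefinite_integral_continuous_1[of f "a - h" "b - h"]])
       (use f in \<open>auto intro!: continuous_intros\<close>)
  ultimately have "continuous_on {a..b} (\<lambda>x. real n * (integral {a - h..x} f - integral {a - h..x - h} f))"
    by (intro continuous_intros)
  then show ?thesis using eq by (subst continuous_on_cong[OF refl]) auto
qed

lemma steklov_periodic_integrable:
  assumes f: "periodic_integrable f"
  shows "periodic_integrable (steklov n f)"
proof (rule periodic_integrableI)
  show "steklov n f (t + 1) = steklov n f t" for t
    using f by (simp add: steklov_shift[symmetric] periodic_integrable_def)
  show "steklov n f absolutely_integrable_on {0..1}"
    by (intro absolutely_integrable_continuous_real steklov_continuous f)
qed

lemma steklov_add:
  assumes "periodic_integrable f" "periodic_integrable g"
  shows "steklov n (\<lambda>t. f t + g t) = (\<lambda>t. steklov n f t + steklov n g t)"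
  unfolding steklov_def using assms
  by (subst Henstock_Kurzweil_Integration.integral_add) (auto simp: algebra_simps)

lemma steklov_diff:
  assumes "periodic_integrable f" "periodic_integrable g"
  shows "steklov n (\<lambda>t. f t - g t) = (\<lambda>t. steklov n f t - steklov n g t)"
  unfolding steklov_def using assms
  by (subst Henstock_Kurzweil_Integration.integral_diff) (auto simp: algebra_simps)

lemma steklov_cmult: "steklov n (\<lambda>t. c * f t) = (\<lambda>t. c * steklov n f t)"
  by (simp add: steklov_def mult.left_commute fun_eq_iff)

lemma steklov_const:
  assumes "n \<ge> 1"
  shows "steklov n (\<lambda>t. c) = (\<lambda>t. c)"
  using assms by (auto simp: steklov_def)

lemma steklov_sum:
  assumes "finite I" "\<And>i. i \<in> I \<Longrightarrow> periodic_integrable (f i)"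
  shows "steklov n (\<lambda>t. \<Sum>i\<in>I. f i t) = (\<lambda>t. \<Sum>i\<in>I. steklov n (f i) t)"
  unfolding steklov_def using assms
  by (subst Henstock_Kurzweil_Integration.integral_sum) (auto simp: sum_distrib_left)

lemma steklov_mono:
  assumes "periodic_integrable f" "periodic_integrable g" 
    and "\<And>t. t \<in> {x - 1 / real n..x} \<Longrightarrow> f t \<le> g t"
  shows "steklov n f x \<le> steklov n g x"
  unfolding steklov_def using assms by (intro mult_left_mono integral_le) auto

lemma steklov_funpow_periodic_integrable:
  "periodic_integrable f \<Longrightarrow> periodic_integrable ((steklov n ^^ j) f)"
  by (induction j) (auto intro: steklov_periodic_integrable)

text \<open>Averaging is linear and commutes with translations, and \<open>bdiff\<close> is a
  combination of translations.\<close>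

lemma bdiff_steklov:
  assumes f: "periodic_integrable f"
  shows "bdiff n (steklov n f) = steklov n (bdiff n f)"
proof
  fix x
  have "steklov n (bdiff n f) x = steklov n (\<lambda>t. real n * (f t - f (t + - (1 / real n)))) x"
    by (simp add: bdiff_def[abs_def])
  also have "\<dots> = real n * (steklov n f x - steklov n f (x + - (1 / real n)))"
    using f by (simp only: steklov_cmult steklov_diff periodic_integrable_shift steklov_shift)
  finally show "bdiff n (steklov n f) x = steklov n (bdiff n f) x"
    by (simp add: bdiff_def)
qed

lemma bdiff_steklov_funpow:
  assumes f: "periodic_integrable f"
  shows "bdiff n ((steklov n ^^ j) f) = (steklov n ^^ j) (bdiff n f)"
  by (induction j) (simp_all add: bdiff_steklov steklov_funpow_periodic_integrable f)

text \<open>The integrated form of \<open>(A f)' = D f\<close>, valid for merely integrable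
  \<open>f\<close>: split the integral over \<open>[s - 1/n, t]\<close> once at
  \<open>t - 1/n\<close> and once at \<open>s\<close>.\<close>

lemma steklov_increment:
  assumes f: "periodic_integrable f" and "s \<le> t"
  shows "steklov n f t - steklov n f s = integral {s..t} (bdiff n f)"
proof -
  define h where "h = 1 / real n"
  have h: "h \<ge> 0" by (simp add: h_def)
  have "integral {s..t} (bdiff n f) = real n * integral {s..t} (\<lambda>x. f x - f (x + - h))"
    by (simp add: bdiff_def[abs_def] h_def)
  also have "integral {s..t} (\<lambda>x. f x - f (x + - h)) = integral {s..t} f - integral {s - h..t - h} f"
    using f periodic_integrable_shift[OF f, of "- h"]
    by (subst Henstock_Kurzweil_Integration.integral_diff) (use integral_shift[of s t f "- h"] in auto)
  also have "\<dots> = integral {t - h..t} f - integral {s - h..s} f"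
    using periodic_integral_combine[OF f, of "s - h" "t - h" t]
      periodic_integral_combine[OF f, of "s - h" s t] h \<open>s \<le> t\<close> by simp
  finally show ?thesis by (simp add: steklov_def h_def algebra_simps)
qed

text \<open>This identity takes the place of Fubini's theorem for the iterated averages.\<close>

lemma steklov_grid_sum:
  assumes n: "n \<ge> 1" and f: "periodic_integrable f"
  shows "(\<Sum>i<n. (steklov n ^^ Suc j) f (x + real i / real n)) = real n * integral {0..1} f"
proof (induction j arbitrary: x)
  case 0
  \<comment> \<open>For a single average, the \<open>n\<close> windows tile one period.\<close>
  have *: "(\<Sum>i<m. integral {y + real i / n..y + real (Suc i) / n} f) = integral {y..y + real m / n} f" for m y
  proof (induction m)
    case (Suc m)
    have "integral {y..y + real m / n} f + integral {y + real m / n..y + real (Suc m) / n} f =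
        integral {y..y + real (Suc m) / n} f"
      by (intro periodic_integral_combine f) (auto simp: divide_right_mono)
    with Suc show ?case by simp
  qed simp
  have "x + real i / n - 1 / n = (x - 1 / n) + real i / n" 
    "x + real i / n = (x - 1 / n) + real (Suc i) / n" for i
    by (simp_all add: add_divide_distrib)
  then have "(\<Sum>i<n. integral {x + real i / n - 1 / n..x + real i / n} f) =
      (\<Sum>i<n. integral {(x - 1 / n) + real i / n..(x - 1 / n) + real (Suc i) / n} f)"
    by (intro sum.cong refl) metis
  also have "\<dots> = integral {(x - 1 / n)..(x - 1 / n) + real n / n} f"
    by (rule *)
  also have "\<dots> = integral {0..1} f"
    using n integral_over_period[OF f, of "x - 1 / n"] by simp
  finally show ?case by (simp add: steklov_def sum_distrib_left[symmetric])
next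
  case (Suc j)
  let ?g = "(steklov n ^^ Suc j) f"
  have g: "periodic_integrable ?g" by (rule steklov_funpow_periodic_integrable[OF f])
  have "(\<Sum>i<n. (steklov n ^^ Suc (Suc j)) f (x + real i / n)) = (\<Sum>i<n. steklov n (\<lambda>t. ?g (t + real i / n)) x)"
    by (simp add: steklov_shift)
  also have "\<dots> = steklov n (\<lambda>t. \<Sum>i<n. ?g (t + real i / n)) x"
    by (simp only: steklov_sum[OF finite_lessThan periodic_integrable_shift[OF g]])
  \<comment> \<open>The induction hypothesis, available at every base point, says that the sum of
    the translates is a constant function, and averaging fixes constants.\<close>
  also have "\<dots> = real n * integral {0..1} f"
    unfolding Suc using steklov_const[OF n] by simp
  finally show ?case .
qed

text \<open>All \<open>n\<close> translates by multiples of \<open>1/n\<close> have the same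
  integral, while by \<open>steklov_grid_sum\<close> they add up to the constant \<open>n\<close>
  times the mean of \<open>f\<close>.\<close>

lemma integral_steklov_funpow:
  assumes n: "n \<ge> 1" and f: "periodic_integrable f"
  shows "integral {0..1} ((steklov n ^^ j) f) = integral {0..1} f"
proof (cases j)
  case (Suc j')
  let ?g = "(steklov n ^^ j) f"
  have g: "periodic_integrable ?g" by (rule steklov_funpow_periodic_integrable[OF f])
  have "real n * integral {0..1} ?g = (\<Sum>i<n. integral {0..1} (\<lambda>t. ?g (t + real i / n)))"
    by (simp add: integral_period_shift[OF g])
  also have "\<dots> = integral {0..1} (\<lambda>t. \<Sum>i<n. ?g (t + real i / n))"
    by (subst Henstock_Kurzweil_Integration.integral_sum) (auto intro: periodic_integrable_shift[OF g])
  also have "\<dots> = real n * integral {0..1} f"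
    unfolding Suc steklov_grid_sum[OF n f] by simp
  finally show ?thesis using n by simp
qed simp

text \<open>Jensen: the affine minorant at the averaged vector lies below \<open>K\<close> on the
  window, and averaging preserves affine expressions and order. A majorant \<open>K\<close> in place
  of \<open>N (f t) powr q\<close> itself lets the estimate be iterated, with
  \<open>steklov n K\<close> as the next majorant; asking for it only on the window permits local
  bounds.\<close>

lemma norm_steklov_powr_le:
  assumes N: "norm_on_Rd d N" and q: "q \<ge> (1::real)" and n: "n \<ge> 1"
    and f: "\<And>t. f t \<in> Rd d" "\<And>k. periodic_integrable (\<lambda>t. f t k)"
    and K: "periodic_integrable K" "\<And>t. t \<in> {x - 1 / real n..x} \<Longrightarrow> N (f t) powr q \<le> K t"
  shows "N (\<lambda>k. steklov n (\<lambda>t. f t k) x) powr q \<le> steklov n K x"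
proof -
  have Rd: "(\<lambda>k. steklov n (\<lambda>t. f t k) x) \<in> Rd d"
    using f(1) by (simp add: Rd_def steklov_def)
  obtain c0 c where c: "N (\<lambda>k. steklov n (\<lambda>t. f t k) x) powr q = c0 + (\<Sum>k<d. c k * steklov n (\<lambda>t. f t k) x)"
    "\<And>y. y \<in> Rd d \<Longrightarrow> c0 + (\<Sum>k<d. c k * y k) \<le> N y powr q"
    by (rule norm_powr_supporting_affine[OF N Rd q]) (rule that; assumption)
  have int: "periodic_integrable (\<lambda>t. \<Sum>k<d. c k * f t k)"
    by (intro periodic_integrable_sum periodic_integrable_cmult f) auto
  have "c0 + (\<Sum>k<d. c k * steklov n (\<lambda>t. f t k) x) = steklov n (\<lambda>t. c0) x + steklov n (\<lambda>t. \<Sum>k<d. c k * f t k) x"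
    using f(2) by (simp add: steklov_const[OF n] steklov_sum steklov_cmult periodic_integrable_cmult)
  also have "\<dots> = steklov n (\<lambda>t. c0 + (\<Sum>k<d. c k * f t k)) x"
    by (simp add: steklov_add periodic_integrable_const int)
  also have "\<dots> \<le> steklov n K x"
    using c(2) f(1) K(2)
    by (intro steklov_mono K(1) periodic_integrable_add periodic_integrable_const int) (meson order_trans)
  finally show ?thesis by (simp add: c(1))
qed

lemma steklov_funpow_Rd:
  assumes "\<And>t. f t \<in> Rd d"
  shows "(\<lambda>k. (steklov n ^^ j) (\<lambda>t. f t k) x) \<in> Rd d"
proof -
  have "(steklov n ^^ j) (\<lambda>t. 0) = (\<lambda>t. 0)" by (induction j) (auto simp: steklov_def)
  then show ?thesis using assms by (simp add: Rd_def)
qed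

lemma norm_steklov_funpow_powr_le:
  assumes N: "norm_on_Rd d N" and q: "q \<ge> (1::real)" and n: "n \<ge> 1"
    and f: "\<And>t. f t \<in> Rd d" "\<And>k. periodic_integrable (\<lambda>t. f t k)"
    and K: "periodic_integrable K" "\<And>t. N (f t) powr q \<le> K t"
  shows "N (\<lambda>k. (steklov n ^^ j) (\<lambda>t. f t k) x) powr q \<le> (steklov n ^^ j) K x"
proof (induction j arbitrary: x)
  case (Suc j)
  show ?case
    unfolding funpow.simps o_apply
    using norm_steklov_powr_le[OF N q n, of "\<lambda>t k. (steklov n ^^ j) (\<lambda>s. f s k) t" "(steklov n ^^ j) K" x,
      OF steklov_funpow_Rd[OF f(1)] steklov_funpow_periodic_integrable[OF f(2)]
        steklov_funpow_periodic_integrable[OF K(1)] Suc] .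
qed (use K in simp)

section \<open>Trigonometric test functions\<close>

text \<open>Products are included so that this is the algebra generated by cosine and sine: it is
  closed under differentiation, and it contains every real polynomial restricted to the unit
  circle.\<close>

inductive trig_poly :: "(real \<Rightarrow> real) \<Rightarrow> bool" where
  const: "trig_poly (\<lambda>t. c)"
| cos: "trig_poly (\<lambda>t. cos (2 * pi * t))"
| sin: "trig_poly (\<lambda>t. sin (2 * pi * t))"
| add: "trig_poly f \<Longrightarrow> trig_poly g \<Longrightarrow> trig_poly (\<lambda>t. f t + g t)"
| mult: "trig_poly f \<Longrightarrow> trig_poly g \<Longrightarrow> trig_poly (\<lambda>t. f t * g t)"

lemma trig_poly_has_derivative:
  assumes "trig_poly f"
  shows "\<exists>f'. trig_poly f' \<and> (\<forall>t. (f has_real_derivative f' t) (at t))"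
  using assms
proof induction
  case const
  then show ?case by (intro exI[of _ "\<lambda>t. 0"]) (auto intro: trig_poly.const)
next
  case cos
  show ?case
    by (intro exI[of _ "\<lambda>t. (- 2 * pi) * sin (2 * pi * t)"] conjI allI
          trig_poly.mult trig_poly.const trig_poly.sin) (auto intro!: derivative_eq_intros)
next
  case sin
  show ?case
    by (intro exI[of _ "\<lambda>t. (2 * pi) * cos (2 * pi * t)"] conjI allI
          trig_poly.mult trig_poly.const trig_poly.cos) (auto intro!: derivative_eq_intros)
next
  case (add f g)
  then obtain f' g' where "trig_poly f'" "trig_poly g'"
    and "\<And>t. (f has_real_derivative f' t) (at t)" "\<And>t. (g has_real_derivative g' t) (at t)"
    by blast
  then show ?case
    by (intro exI[of _ "\<lambda>t. f' t + g' t"]) (auto intro: trig_poly.add DERIV_add)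
next
  case (mult f g)
  then obtain f' g' where "trig_poly f'" "trig_poly g'"
    and "\<And>t. (f has_real_derivative f' t) (at t)" "\<And>t. (g has_real_derivative g' t) (at t)"
    by blast
  with mult.hyps show ?case
    by (intro exI[of _ "\<lambda>t. f' t * g t + g' t * f t"])
       (auto intro: trig_poly.add trig_poly.mult DERIV_mult)
qed

lemma trig_poly_periodic: "trig_poly f \<Longrightarrow> f (t + 1) = f t"
  by (induction rule: trig_poly.induct) (simp_all add: distrib_left)

lemma trig_poly_smooth:
  assumes "trig_poly f"
  shows "smooth_periodic f"
proof -
  have step: "trig_poly (deriv g) \<and> (\<forall>t. g field_differentiable (at t))" if g: "trig_poly g" for g
  proof -
    obtain g' where g': "trig_poly g'" "\<And>t. (g has_real_derivative g' t) (at t)"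
      using trig_poly_has_derivative[OF g] by blast
    then have "deriv g = g'" by (intro ext DERIV_imp_deriv)
    with g' show ?thesis by (auto simp: field_differentiable_def)
  qed
  have "trig_poly ((deriv ^^ r) f)" for r
    by (induction r) (use assms step in auto)
  with step show ?thesis
    by (auto simp: smooth_periodic_def trig_poly_periodic[OF assms])
qed

lemma smooth_periodic_DERIV:
  assumes "smooth_periodic f"
  shows "(f has_real_derivative deriv f t) (at t)"
proof -
  have "(deriv ^^ 0) f field_differentiable (at t)"
    using assms unfolding smooth_periodic_def by blast
  then show ?thesis by (simp add: DERIV_deriv_iff_field_differentiable)
qed

lemma smooth_periodic_deriv:
  assumes f: "smooth_periodic f"
  shows "smooth_periodic (deriv f)"
  unfolding smooth_periodic_def
proof (intro conjI allI)
  fix t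
  have "((\<lambda>x. f (x + 1)) has_real_derivative deriv f (t + 1)) (at t)"
    using smooth_periodic_DERIV[OF f, of "t + 1"] by (simp add: DERIV_shift)
  moreover have "(\<lambda>x. f (x + 1)) = f"
    using f by (auto simp: smooth_periodic_def)
  ultimately show "deriv f (t + 1) = deriv f t"
    by (simp add: DERIV_imp_deriv)
next
  fix r t
  have "(deriv ^^ Suc r) f field_differentiable at t"
    using f unfolding smooth_periodic_def by blast
  then show "(deriv ^^ r) (deriv f) field_differentiable at t"
    by (simp only: funpow_Suc_right o_apply)
qed

lemma smooth_periodic_higher_deriv: "smooth_periodic f \<Longrightarrow> smooth_periodic ((deriv ^^ r) f)"
  by (induction r) (auto intro: smooth_periodic_deriv)

text \<open>Periodicity of the antiderivative is a separate hypothesis; it amounts to mean zero of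
  \<open>g\<close>, which is arranged where the lemma is applied.\<close>

lemma smooth_periodic_antiderivative:
  assumes g: "smooth_periodic g" and per: "\<And>t. f (t + 1) = f t"
    and der: "\<And>t. (f has_real_derivative g t) (at t)"
  shows "smooth_periodic f"
  unfolding smooth_periodic_def
proof (intro conjI allI per)
  fix r t
  have eq: "deriv f = g" using der by (intro ext DERIV_imp_deriv)
  show "(deriv ^^ r) f field_differentiable at t"
  proof (cases r)
    case 0
    then show ?thesis using der by (auto simp: field_differentiable_def)
  next
    case (Suc r')
    then have "(deriv ^^ r) f = (deriv ^^ r') g"
      by (simp only: funpow_Suc_right o_apply eq)
    with g show ?thesis by (simp add: smooth_periodic_def)
  qed
qed

lemma smooth_periodic_continuous_on: "smooth_periodic f \<Longrightarrow> continuous_on A f"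
  by (meson DERIV_continuous continuous_at_imp_continuous_on smooth_periodic_DERIV)

lemma smooth_periodic_diff_const:
  assumes "smooth_periodic f"
  shows "smooth_periodic (\<lambda>t. f t - c)"
proof -
  show ?thesis
    using smooth_periodic_DERIV[OF assms] assms
    by (intro smooth_periodic_antiderivative[OF smooth_periodic_deriv[OF assms]])
       (auto intro!: derivative_eq_intros simp: smooth_periodic_def)
qed

lemma trig_poly_real_polynomial_cis:
  assumes "real_polynomial_function p"
  shows "trig_poly (\<lambda>t. p (cis (2 * pi * t)))"
  using assms
proof induction
  case (linear f)
  then interpret bounded_linear f .
  have "f (cis x) = f 1 * cos x + f \<i> * sin x" for x
  proof -
    have "cis x = cos x *\<^sub>R 1 + sin x *\<^sub>R \<i>"
      by (simp add: complex_eq_iff)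
    then have "f (cis x) = cos x *\<^sub>R f 1 + sin x *\<^sub>R f \<i>"
      by (simp only: add scaleR)
    then show ?thesis by simp
  qed
  then show ?case
    by (auto intro!: trig_poly.add trig_poly.mult trig_poly.const trig_poly.cos trig_poly.sin)
qed (auto intro: trig_poly.intros)

text \<open>A function on the unit interval with equal end values is a continuous function on the
  circle, where Stone-Weierstrass applies.\<close>

lemma trig_poly_approx:
  fixes \<psi> :: "real \<Rightarrow> real"
  assumes cont: "continuous_on {0..1} \<psi>" and ends: "\<psi> 0 = \<psi> 1" and e: "e > 0"
  obtains \<phi> where "trig_poly \<phi>" "\<And>t. t \<in> {0..1} \<Longrightarrow> \<bar>\<psi> t - \<phi> t\<bar> < e"
proof -
  let ?h = "\<psi> \<circ> (\<lambda>z. Arg2pi z / (2 * pi))"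
  \<comment> \<open>The trivial homotopy of a loop with itself is used only to obtain continuity of
    the induced map on the circle, including at the branch point of \<open>Arg2pi\<close>.\<close>
  have "homotopic_loops UNIV \<psi> \<psi>"
    using cont ends by (auto simp: homotopic_loops_refl path_def pathfinish_def pathstart_def)
  then have "continuous_on (sphere 0 1) ?h"
    using homotopic_loops_imp_homotopic_circlemaps homotopic_with_imp_continuous by blast
  then obtain p where p: "real_polynomial_function p"
    "\<And>z. z \<in> sphere 0 1 \<Longrightarrow> \<bar>?h z - p z\<bar> < e"
    using Stone_Weierstrass_real_polynomial_function[of "sphere 0 1" ?h e] e by auto
  have h: "?h (cis (2 * pi * t)) = \<psi> t" if "t \<in> {0..1}" for t
  proof (cases "t = 1")
    case True
    have "Arg2pi 1 = 0" using Arg2pi_of_real[of 1] by simp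
    with True ends show ?thesis by simp
  next
    case False
    then have "Arg2pi (cis (2 * pi * t)) = 2 * pi * t"
      using that by (intro Arg2pi_unique[of 1]) (auto simp: cis_conv_exp)
    then show ?thesis by simp
  qed
  show ?thesis
  proof (rule that[OF trig_poly_real_polynomial_cis[OF p(1)]])
    fix t :: real assume "t \<in> {0..1}"
    then show "\<bar>\<psi> t - p (cis (2 * pi * t))\<bar> < e"
      using p(2)[of "cis (2 * pi * t)"] h by simp
  qed
qed

lemma absolutely_integrable_mult_continuous:
  fixes w :: "real \<Rightarrow> real"
  assumes "w absolutely_integrable_on {a..b}" "continuous_on {a..b} \<phi>"
  shows "(\<lambda>t. w t * \<phi> t) absolutely_integrable_on {a..b}"
proof -
  have "(\<lambda>t. \<phi> t * w t) absolutely_integrable_on {a..b}"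
    using assms
    by (intro absolutely_integrable_bounded_measurable_product_real)
       (auto intro: continuous_imp_measurable_on_sets_lebesgue compact_imp_bounded compact_continuous_image)
  then show ?thesis by (simp add: mult.commute)
qed

lemma integrable_on_mult_continuous:
  fixes w :: "real \<Rightarrow> real"
  assumes "w absolutely_integrable_on {a..b}" "continuous_on {a..b} \<phi>"
  shows "(\<lambda>t. w t * \<phi> t) integrable_on {a..b}"
  using absolutely_integrable_mult_continuous[OF assms] by (simp add: absolutely_integrable_on_def)

lemma integral_mult_eq_0_of_trig_poly:
  fixes w :: "real \<Rightarrow> real"
  assumes w: "w absolutely_integrable_on {0..1}"
    and zero: "\<And>\<phi>. trig_poly \<phi> \<Longrightarrow> integral {0..1} (\<lambda>t. w t * \<phi> t) = 0"
    and cont: "continuous_on {0..1} \<psi>" and ends: "\<psi> 0 = \<psi> 1"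
  shows "integral {0..1} (\<lambda>t. w t * \<psi> t) = 0"
proof -
  define C where "C = integral {0..1} (\<lambda>t. \<bar>w t\<bar>)"
  have absw: "(\<lambda>t. \<bar>w t\<bar>) integrable_on {0..1}"
    using w by (simp add: absolutely_integrable_on_def)
  have C: "C \<ge> 0" unfolding C_def by (intro integral_nonneg absw) auto
  have bound: "\<bar>integral {0..1} (\<lambda>t. w t * \<psi> t)\<bar> \<le> e * C" if e: "e > 0" for e
  proof -
    obtain \<phi> where \<phi>: "trig_poly \<phi>" "\<And>t. t \<in> {0..1} \<Longrightarrow> \<bar>\<psi> t - \<phi> t\<bar> < e"
      using trig_poly_approx[OF cont ends e] by blast
    have c: "continuous_on {0..1} \<phi>"
      using trig_poly_smooth[OF \<phi>(1)] by (rule smooth_periodic_continuous_on)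
    have "integral {0..1} (\<lambda>t. w t * \<psi> t) = integral {0..1} (\<lambda>t. w t * (\<psi> t - \<phi> t))"
      using zero[OF \<phi>(1)] integrable_on_mult_continuous[OF w cont] integrable_on_mult_continuous[OF w c]
      by (simp add: right_diff_distrib Henstock_Kurzweil_Integration.integral_diff)
    also have "norm \<dots> \<le> integral {0..1} (\<lambda>t. e * \<bar>w t\<bar>)"
    proof (rule integral_norm_bound_integral)
      show "(\<lambda>t. w t * (\<psi> t - \<phi> t)) integrable_on {0..1}"
        using cont c by (intro integrable_on_mult_continuous w continuous_intros)
      show "(\<lambda>t. e * \<bar>w t\<bar>) integrable_on {0..1}"
        using integrable_cmul[OF absw, of e] by simp
      show "norm (w t * (\<psi> t - \<phi> t)) \<le> e * \<bar>w t\<bar>" if "t \<in> {0..1}" for t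
        using mult_left_mono[of "\<bar>\<psi> t - \<phi> t\<bar>" e "\<bar>w t\<bar>"] \<phi>(2)[OF that] by (simp add: abs_mult mult.commute)
    qed
    also have "\<dots> = e * C" by (simp add: C_def)
    finally show ?thesis by simp
  qed
  show ?thesis
  proof (rule ccontr)
    let ?I = "\<bar>integral {0..1} (\<lambda>t. w t * \<psi> t)\<bar>"
    assume "integral {0..1} (\<lambda>t. w t * \<psi> t) \<noteq> 0"
    then have pos: "?I > 0" by simp
    \<comment> \<open>The choice of \<open>e\<close>; the added 1 covers the case
      \<open>C = 0\<close>.\<close>
    then have "?I \<le> ?I / (C + 1) * C"
      using C by (intro bound divide_pos_pos) auto
    also have "\<dots> < ?I" using pos C by (simp add: field_simps)
    finally show False by simp
  qed
qed

lemma negligible_support_of_integral_abs_0: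
  fixes w :: "real \<Rightarrow> real"
  assumes w: "w absolutely_integrable_on {0..1}" and zero: "integral {0..1} (\<lambda>t. \<bar>w t\<bar>) = 0"
  obtains Z where "negligible Z" "\<And>t. t \<in> {0..1} - Z \<Longrightarrow> w t = 0"
proof -
  have int: "integrable (lebesgue_on {0..1}) (\<lambda>t. \<bar>w t\<bar>)"
    using absolutely_integrable_imp_integrable[OF absolutely_integrable_norm[OF w]] by (simp add: o_def)
  have "integral\<^sup>L (lebesgue_on {0..1}) (\<lambda>t. \<bar>w t\<bar>) = 0"
    using zero lebesgue_integral_eq_integral[OF int] by simp
  then have "AE t in lebesgue_on {0..1}. \<bar>w t\<bar> = 0"
    using integral_nonneg_eq_0_iff_AE[OF int] by simp
  then have "AE t in lebesgue. t \<in> {0..1} \<longrightarrow> \<bar>w t\<bar> = 0"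
    by (simp add: AE_restrict_space_iff)
  then obtain Z where "{t. \<not> (t \<in> {0..1} \<longrightarrow> \<bar>w t\<bar> = 0)} \<subseteq> Z" "Z \<in> null_sets lebesgue"
    unfolding eventually_ae_filter by auto
  then show ?thesis by (intro that[of Z]) (auto simp: negligible_iff_null_sets)
qed

text \<open>Testing with \<open>sgn (w t)\<close> would give the L1 norm of \<open>w\<close>. The
  sign is approximated almost everywhere by bounded continuous functions with equal end values, and
  dominated convergence passes to the limit.\<close>

lemma fundamental_lemma_periodic:
  fixes w :: "real \<Rightarrow> real"
  assumes w: "w absolutely_integrable_on {0..1}"
    and zero: "\<And>\<phi>. trig_poly \<phi> \<Longrightarrow> integral {0..1} (\<lambda>t. w t * \<phi> t) = 0"
  obtains Z where "negligible Z" "\<And>t. t \<in> {0..1} - Z \<Longrightarrow> w t = 0"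
proof -
  have "w \<in> borel_measurable (lebesgue_on {0..1})"
    using w by (intro integrable_imp_measurable) (simp add: absolutely_integrable_on_def)
  then have "(\<lambda>t. sgn (w t)) \<in> borel_measurable (lebesgue_on {0..1})"
    by measurable
  then have "(\<lambda>t. sgn (w t)) measurable_on {0..1}"
    by (simp add: measurable_on_iff_borel_measurable)
  then obtain Z g where Z: "negligible Z" and g: "\<And>n. continuous_on UNIV (g n)"
    and lim: "\<And>t. t \<notin> Z \<Longrightarrow> (\<lambda>n. g n t) \<longlonglongrightarrow> (if t \<in> {0..1} then sgn (w t) else 0)"
    unfolding measurable_on_def by blast
  \<comment> \<open>The first factor vanishes at 0 and 1, which makes the end values agree, and
    becomes 1 at each interior point for large \<open>n\<close>. Clamping the second factor to
    \<open>[-1, 1]\<close> provides the dominating function, and leaves the limit unchanged since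
    signs lie in that range.\<close>
  define \<psi> where "\<psi> n t = min 1 (real n * (t * (1 - t))) * max (-1) (min 1 (g n t))" for n t
  define S where "S = {0<..<1} - Z"
  have neg: "negligible {x \<in> {0..1} - S. f x \<noteq> 0}" "negligible {x \<in> S - {0..1}. f x \<noteq> 0}" for f :: "real \<Rightarrow> real"
  proof -
    have "negligible (insert 0 (insert 1 Z))" using Z by simp
    then show "negligible {x \<in> {0..1} - S. f x \<noteq> 0}"
      by (rule negligible_subset) (auto simp: S_def)
    show "negligible {x \<in> S - {0..1}. f x \<noteq> 0}"
      by (rule negligible_subset[of "{}"]) (auto simp: S_def)
  qed
  have absw: "(\<lambda>t. \<bar>w t\<bar>) integrable_on {0..1}"
    using w by (simp add: absolutely_integrable_on_def)
  have cont: "continuous_on {0..1} (\<psi> n)" for n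
    unfolding \<psi>_def by (intro continuous_intros continuous_on_subset[OF g]) auto
  have spike: "f integrable_on S \<longleftrightarrow> f integrable_on {0..1}" "integral S f = integral {0..1} f" for f :: "real \<Rightarrow> real"
    using integrable_spike_set_eq[of S "{0..1}" f] integral_spike_set[of S "{0..1}" f] neg[of f]
    by (auto intro: integrable_spike_set)
  have "(\<lambda>n. integral S (\<lambda>t. w t * \<psi> n t)) \<longlonglongrightarrow> integral S (\<lambda>t. \<bar>w t\<bar>)"
  proof (rule dominated_convergence(2))
    show "(\<lambda>t. w t * \<psi> n t) integrable_on S" for n
      unfolding spike by (rule integrable_on_mult_continuous[OF w cont])
    show "(\<lambda>t. \<bar>w t\<bar>) integrable_on S" unfolding spike by (rule absw)
    show "norm (w t * \<psi> n t) \<le> \<bar>w t\<bar>" if "t \<in> S" for n t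
    proof -
      have "0 \<le> t * (1 - t)" using that by (auto simp: S_def)
      then have "0 \<le> min 1 (real n * (t * (1 - t)))" by simp
      moreover have "\<bar>max (-1) (min 1 (g n t))\<bar> \<le> 1" by auto
      ultimately have "\<bar>\<psi> n t\<bar> \<le> 1 * 1"
        unfolding \<psi>_def abs_mult by (intro mult_mono) auto
      then show ?thesis by (simp add: abs_mult mult_left_le)
    qed
    show "(\<lambda>n. w t * \<psi> n t) \<longlonglongrightarrow> \<bar>w t\<bar>" if t: "t \<in> S" for t
    proof -
      have pos: "0 < t * (1 - t)" using t by (auto simp: S_def)
      have ev: "\<forall>\<^sub>F n in sequentially. min 1 (real n * (t * (1 - t))) = 1"
        using eventually_ge_at_top[of "nat \<lceil>1 / (t * (1 - t))\<rceil>"]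
      proof eventually_elim
        case (elim n)
        then have "1 / (t * (1 - t)) \<le> real n" by linarith
        then have "1 \<le> real n * (t * (1 - t))" using pos by (simp only: pos_divide_le_eq)
        then show ?case by simp
      qed
      have "(\<lambda>n. g n t) \<longlonglongrightarrow> sgn (w t)"
        using lim[of t] t by (auto simp: S_def)
      then have "(\<lambda>n. \<psi> n t) \<longlonglongrightarrow> 1 * max (-1) (min 1 (sgn (w t)))"
        unfolding \<psi>_def by (intro tendsto_intros tendsto_eventually[OF ev] tendsto_max tendsto_min)
      then have "(\<lambda>n. w t * \<psi> n t) \<longlonglongrightarrow> w t * (1 * max (-1) (min 1 (sgn (w t))))"
        by (intro tendsto_intros)
      also have "w t * (1 * max (-1) (min 1 (sgn (w t)))) = \<bar>w t\<bar>"
        by (auto simp: sgn_if)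
      finally show ?thesis .
    qed
  qed
  moreover have "integral S (\<lambda>t. w t * \<psi> n t) = 0" for n
    unfolding spike
    by (rule integral_mult_eq_0_of_trig_poly[OF w zero cont]) (auto simp: \<psi>_def)
  ultimately have "integral {0..1} (\<lambda>t. \<bar>w t\<bar>) = 0"
    by (simp add: spike LIMSEQ_const_iff)
  then show ?thesis
    by (rule negligible_support_of_integral_abs_0[OF w]) (rule that, auto)
qed

section \<open>Weak derivatives and primitives\<close>

text \<open>Over \<open>n\<close> equal cells the bounds telescope to
  \<open>(W 1 - W 0) / n\<close>, and \<open>n\<close> is arbitrary.\<close>

lemma increments_eq_of_superadditive_bound:
  fixes H W :: "real \<Rightarrow> real"
  assumes bound: "\<And>s t. 0 \<le> s \<Longrightarrow> s \<le> t \<Longrightarrow> t \<le> 1 \<Longrightarrow> \<bar>H t - H s\<bar> \<le> (t - s) * (W t - W s)"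
  shows "H 1 = H 0"
proof -
  have est: "\<bar>H 1 - H 0\<bar> \<le> (W 1 - W 0) / real n" if n: "n \<ge> 1" for n
  proof -
    have step: "\<bar>H (real (Suc i) / n) - H (real i / n)\<bar> \<le> (W (real (Suc i) / n) - W (real i / n)) / n"
      if i: "i < n" for i
    proof -
      have "real (Suc i) / n - real i / n = 1 / n"
        by (simp add: diff_divide_distrib[symmetric])
      moreover have "real (Suc i) / n \<le> 1" using i by (simp add: field_simps)
      ultimately show ?thesis
        using bound[of "real i / n" "real (Suc i) / n"] by (simp add: divide_right_mono)
    qed
    have "H 1 - H 0 = (\<Sum>i<n. H (real (Suc i) / n) - H (real i / n))"
      using n sum_lessThan_telescope[of "\<lambda>i. H (real i / n)" n] by simp
    then have "\<bar>H 1 - H 0\<bar> \<le> (\<Sum>i<n. \<bar>H (real (Suc i) / n) - H (real i / n)\<bar>)"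
      using sum_abs by metis
    also have "\<dots> \<le> (\<Sum>i<n. (W (real (Suc i) / n) - W (real i / n)) / n)"
      by (intro sum_mono step) simp
    also have "\<dots> = (W 1 - W 0) / n"
      using n sum_lessThan_telescope[of "\<lambda>i. W (real i / n)" n]
      by (simp add: sum_divide_distrib[symmetric])
    finally show ?thesis .
  qed
  have "(\<lambda>n. (W 1 - W 0) / real n) \<longlonglongrightarrow> 0"
    by (rule lim_const_over_n)
  then have "\<bar>H 1 - H 0\<bar> \<le> 0"
    by (rule Lim_bounded2[where N = 1]) (use est in auto)
  then show ?thesis by simp
qed

text \<open>
  The defect in the formula for integration by parts over \<open>[s, t]\<close> is of second order,
  namely \<open>O((t - s) \<integral>\<^bsub>s\<^esub>\<^bsup>t\<^esup> |v|)\<close>, so it vanishes.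
\<close>

lemma integral_by_parts_indefinite:
  fixes v \<phi> :: "real \<Rightarrow> real"
  assumes v: "v absolutely_integrable_on {0..1}" and \<phi>: "smooth_periodic \<phi>"
  shows "integral {0..1} (\<lambda>t. integral {0..t} v * deriv \<phi> t) =
    integral {0..1} v * \<phi> 1 - integral {0..1} (\<lambda>t. v t * \<phi> t)"
proof -
  define U where "U t = integral {0..t} v" for t
  define V where "V t = integral {0..t} (\<lambda>x. \<bar>v x\<bar>)" for t
  have vint: "v integrable_on {0..1}" and absv: "(\<lambda>x. \<bar>v x\<bar>) integrable_on {0..1}"
    using v by (simp_all add: absolutely_integrable_on_def)
  have c\<phi>: "continuous_on A \<phi>" and c\<phi>': "continuous_on A (deriv \<phi>)" for A
    using \<phi> by (auto intro: smooth_periodic_continuous_on smooth_periodic_deriv)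
  have cU: "continuous_on {0..1} U"
    unfolding U_def by (rule indefinite_integral_continuous_1[OF vint])
  have U\<phi>': "(\<lambda>x. U x * deriv \<phi> x) integrable_on {0..1}"
    by (intro integrable_continuous_real continuous_intros cU c\<phi>')
  have v\<phi>: "(\<lambda>x. v x * \<phi> x) integrable_on {0..1}"
    by (rule integrable_on_mult_continuous[OF v c\<phi>])
  have "bounded (deriv \<phi> ` {0..1})"
    by (intro compact_imp_bounded compact_continuous_image c\<phi>') simp
  then obtain C where C: "\<And>x. x \<in> {0..1} \<Longrightarrow> \<bar>deriv \<phi> x\<bar> \<le> C" "C > 0"
    unfolding bounded_pos by fastforce
  \<comment> \<open>The defect of the formula over \<open>[0, t]\<close>. As \<open>H 0 = 0\<close>,
    the goal is \<open>H 1 = H 0\<close>.\<close>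
  define H where "H t = U t * \<phi> t - integral {0..t} (\<lambda>x. U x * deriv \<phi> x) - integral {0..t} (\<lambda>x. v x * \<phi> x)" for t
  have "H 1 = H 0"
  proof (rule increments_eq_of_superadditive_bound[where W = "\<lambda>t. 2 * C * V t"])
    fix s t :: real assume st: "0 \<le> s" "s \<le> t" "t \<le> 1"
    have sub: "f integrable_on {a..b}" if "f integrable_on {0..1}" "0 \<le> a" "b \<le> 1" for f :: "real \<Rightarrow> real" and a b
      by (rule integrable_on_subinterval[OF that(1)]) (use that in auto)
    have comb: "integral {0..b} f - integral {0..a} f = integral {a..b} f"
      if "f integrable_on {0..1}" "0 \<le> a" "a \<le> b" "b \<le> 1" for f :: "real \<Rightarrow> real" and a b
    proof -
      have "f integrable_on {0..b}" by (rule sub[OF that(1)]) (use that in auto)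
      from Henstock_Kurzweil_Integration.integral_combine[OF that(2,3) this] show ?thesis by simp
    qed
    define A where "A = integral {s..t} (\<lambda>x. \<bar>v x\<bar>)"
    have A: "A = V t - V s" using comb[OF absv st] by (simp add: A_def V_def)
    have vst: "v integrable_on {s..t}" and absvst: "(\<lambda>x. \<bar>v x\<bar>) integrable_on {s..t}"
      by (rule sub[OF vint st(1,3)] sub[OF absv st(1,3)])+
    have A0: "A \<ge> 0" unfolding A_def by (rule integral_nonneg[OF absvst]) auto
    have absi: "v absolutely_integrable_on {s..t}"
      using vst absvst by (simp add: absolutely_integrable_on_def)
    have i1: "(\<lambda>x. v x * (\<phi> t - \<phi> x)) integrable_on {s..t}"
      by (intro integrable_on_mult_continuous absi continuous_intros c\<phi>)
    have cU': "continuous_on {s..t} U" using cU st by (auto intro: continuous_on_subset)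
    have i2: "(\<lambda>x. (U s - U x) * deriv \<phi> x) integrable_on {s..t}"
      by (intro integrable_continuous_real continuous_intros cU' c\<phi>')
    have i3: "(\<lambda>x. v x * \<phi> x) integrable_on {s..t}" "(\<lambda>x. U x * deriv \<phi> x) integrable_on {s..t}"
      by (rule sub[OF v\<phi> st(1,3)] sub[OF U\<phi>' st(1,3)])+
    have ftc: "(deriv \<phi> has_integral (\<phi> t - \<phi> s)) {s..t}"
      using smooth_periodic_DERIV[OF \<phi>] st
      by (intro fundamental_theorem_of_calculus)
         (auto simp: has_real_derivative_iff_has_vector_derivative intro: has_vector_derivative_at_within)
    \<comment> \<open>The increment is regrouped so that \<phi> is frozen at \<open>t\<close>
      against \<open>v\<close> and \<open>U\<close> at \<open>s\<close> against the derivative of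
      \<phi>. Each integrand then has a small factor, and each of the two terms contributes
      \<open>C * (t - s)\<close> times the integral of the absolute value of \<open>v\<close>,
      whence the constant \<open>2 * C\<close>.\<close>
    have "H t - H s = ((U t - U s) * \<phi> t - integral {s..t} (\<lambda>x. v x * \<phi> x)) +
        (U s * (\<phi> t - \<phi> s) - integral {s..t} (\<lambda>x. U x * deriv \<phi> x))"
      using comb[OF U\<phi>' st] comb[OF v\<phi> st] by (simp add: H_def algebra_simps)
    also have "(U t - U s) * \<phi> t - integral {s..t} (\<lambda>x. v x * \<phi> x) = integral {s..t} (\<lambda>x. v x * (\<phi> t - \<phi> x))"
      using comb[OF vint st] i3(1) integrable_on_mult_continuous[OF absi continuous_on_const[of _ "\<phi> t"]]
      by (simp add: U_def right_diff_distrib Henstock_Kurzweil_Integration.integral_diff)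
    also have "U s * (\<phi> t - \<phi> s) - integral {s..t} (\<lambda>x. U x * deriv \<phi> x) = integral {s..t} (\<lambda>x. (U s - U x) * deriv \<phi> x)"
      using ftc i3(2) integrable_cmul[of "deriv \<phi>" "{s..t}" "U s"] 
      by (simp add: left_diff_distrib Henstock_Kurzweil_Integration.integral_diff has_integral_iff)
    finally have "H t - H s = integral {s..t} (\<lambda>x. v x * (\<phi> t - \<phi> x) + (U s - U x) * deriv \<phi> x)"
      using i1 i2 by (simp add: Henstock_Kurzweil_Integration.integral_add)
    also have "norm \<dots> \<le> integral {s..t} (\<lambda>x. C * (t - s) * \<bar>v x\<bar> + A * C)"
    proof (rule integral_norm_bound_integral)
      show "(\<lambda>x. v x * (\<phi> t - \<phi> x) + (U s - U x) * deriv \<phi> x) integrable_on {s..t}"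
        using i1 i2 by (rule integrable_add)
      show "(\<lambda>x. C * (t - s) * \<bar>v x\<bar> + A * C) integrable_on {s..t}"
        using integrable_cmul[OF absvst, of "C * (t - s)"] by (intro integrable_add) auto
      fix x assume x: "x \<in> {s..t}"
      have "\<bar>\<phi> t - \<phi> x\<bar> \<le> C * \<bar>t - x\<bar>"
      proof (rule field_differentiable_bound[of "{0..1}" \<phi> "deriv \<phi>", simplified])
        show "(\<phi> has_field_derivative deriv \<phi> z) (at z within {0..1})" for z
          using smooth_periodic_DERIV[OF \<phi>] has_field_derivative_at_within by blast
      qed (use C x st in auto)
      also have "\<dots> \<le> C * (t - s)" using C(2) x by (intro mult_left_mono) auto
      finally have b1: "\<bar>v x * (\<phi> t - \<phi> x)\<bar> \<le> C * (t - s) * \<bar>v x\<bar>"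
        using mult_right_mono[of "\<bar>\<phi> t - \<phi> x\<bar>" "C * (t - s)" "\<bar>v x\<bar>"] by (simp add: abs_mult mult.commute)
      have "\<bar>U s - U x\<bar> = \<bar>integral {s..x} v\<bar>"
        using comb[OF vint, of s x] x st by (simp add: U_def)
      also have "\<dots> \<le> integral {s..x} (\<lambda>y. \<bar>v y\<bar>)"
        using x st integral_norm_bound_integral[OF sub[OF vint, of s x] sub[OF absv, of s x]] by simp
      also have "\<dots> \<le> A" unfolding A_def
        by (rule integral_subset_le[OF _ sub[OF absv] absvst]) (use x st in auto)
      finally have b2: "\<bar>(U s - U x) * deriv \<phi> x\<bar> \<le> A * C"
        unfolding abs_mult using C x st A0 by (intro mult_mono) auto
      show "norm (v x * (\<phi> t - \<phi> x) + (U s - U x) * deriv \<phi> x) \<le> C * (t - s) * \<bar>v x\<bar> + A * C"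
        using b1 b2 by simp
    qed
    also have "\<dots> = C * (t - s) * A + (t - s) * (A * C)"
      using integrable_cmul[OF absvst, of "C * (t - s)"] st
      by (subst Henstock_Kurzweil_Integration.integral_add) (auto simp: A_def)
    also have "\<dots> = (t - s) * (2 * C * V t - 2 * C * V s)"
      by (simp add: A algebra_simps)
    finally show "\<bar>H t - H s\<bar> \<le> (t - s) * (2 * C * V t - 2 * C * V s)" by simp
  qed
  then show ?thesis
    by (simp add: H_def U_def)
qed

text \<open>A trigonometric polynomial minus its mean is the derivative of a periodic test function.
  The weak identity and integration by parts therefore show that \<open>u - U - c\<close> is
  orthogonal to all trigonometric polynomials.\<close>

lemma du_Bois_Reymond_periodic:
  fixes u v :: "real \<Rightarrow> real"
  assumes u: "u absolutely_integrable_on {0..1}" and v: "v absolutely_integrable_on {0..1}"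
    and weak: "\<And>\<phi>. smooth_periodic \<phi> \<Longrightarrow>
      integral {0..1} (\<lambda>t. v t * \<phi> t) = - integral {0..1} (\<lambda>t. u t * deriv \<phi> t)"
  obtains c Z where "integral {0..1} v = 0" "negligible Z"
    "\<And>t. t \<in> {0..1} - Z \<Longrightarrow> u t = c + integral {0..t} v"
proof -
  define U where "U t = integral {0..t} v" for t
  have cU: "continuous_on {0..1} U"
    unfolding U_def using v by (intro indefinite_integral_continuous_1) (simp add: absolutely_integrable_on_def)
  \<comment> \<open>Periodic test functions include the constant 1. The vanishing mean later removes
    the boundary term of the integration by parts.\<close>
  have v0: "integral {0..1} v = 0"
    using weak[OF trig_poly_smooth[OF trig_poly.const[of 1]]] by simp
  define c where "c = integral {0..1} (\<lambda>t. u t - U t)"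
  have uU: "(\<lambda>t. u t - U t) absolutely_integrable_on {0..1}"
    using u absolutely_integrable_continuous_real[OF cU] by auto
  have w: "(\<lambda>t. u t - U t - c) absolutely_integrable_on {0..1}"
    by (intro set_integral_diff uU absolutely_integrable_continuous_real continuous_on_const)
  have zero: "integral {0..1} (\<lambda>t. (u t - U t - c) * \<psi> t) = 0" if \<psi>: "trig_poly \<psi>" for \<psi>
  proof -
    have s\<psi>: "smooth_periodic \<psi>" by (rule trig_poly_smooth[OF \<psi>])
    have c\<psi>: "continuous_on A \<psi>" for A by (rule smooth_periodic_continuous_on[OF s\<psi>])
    \<comment> \<open>Only after subtraction of the mean does an antiderivative become
      periodic.\<close>
    define k where "k = integral {0..1} \<psi>"
    have sk: "smooth_periodic (\<lambda>t. \<psi> t - k)" by (rule smooth_periodic_diff_const[OF s\<psi>])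
    have p\<psi>: "periodic_integrable (\<lambda>t. \<psi> t - k)"
      using sk by (intro periodic_integrableI absolutely_integrable_continuous_real smooth_periodic_continuous_on)
                  (auto simp: smooth_periodic_def)
    have mean: "integral {0..1} (\<lambda>t. \<psi> t - k) = 0"
      by (subst Henstock_Kurzweil_Integration.integral_diff)
         (auto simp: k_def intro: integrable_continuous_real c\<psi>)
    obtain \<phi> where \<phi>: "\<And>t. (\<phi> has_real_derivative \<psi> t - k) (at t)"
    proof -
      have "isCont (\<lambda>t. \<psi> t - k) x" for x
        using smooth_periodic_DERIV[OF sk] DERIV_isCont by blast
      then have "\<exists>F. \<forall>x. (F has_vector_derivative \<psi> x - k) (at x)"
        using einterval_antiderivative[of "-\<infinity>" "\<infinity>" "\<lambda>t. \<psi> t - k"] by simp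
      then show ?thesis
        using that by (auto simp: has_real_derivative_iff_has_vector_derivative)
    qed
    have per: "\<phi> (t + 1) = \<phi> t" for t
    proof -
      have "((\<lambda>t. \<psi> t - k) has_integral (\<phi> (t + 1) - \<phi> t)) {t..t + 1}"
        using \<phi> by (intro fundamental_theorem_of_calculus)
         (auto simp: has_real_derivative_iff_has_vector_derivative intro: has_vector_derivative_at_within)
      then show ?thesis
        using integral_over_period[OF p\<psi>, of t] mean by (simp add: has_integral_iff)
    qed
    have s\<phi>: "smooth_periodic \<phi>" by (rule smooth_periodic_antiderivative[OF sk per \<phi>])
    have d\<phi>: "deriv \<phi> = (\<lambda>t. \<psi> t - k)" using \<phi> by (intro ext DERIV_imp_deriv)
    have c2: "continuous_on {0..1} (\<lambda>t. \<psi> t - k)" by (intro continuous_intros c\<psi>)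
    have "integral {0..1} (\<lambda>t. (u t - U t) * (\<psi> t - k)) =
        integral {0..1} (\<lambda>t. u t * (\<psi> t - k)) - integral {0..1} (\<lambda>t. U t * (\<psi> t - k))"
      using integrable_on_mult_continuous[OF u c2]
        integrable_on_mult_continuous[OF absolutely_integrable_continuous_real[OF cU] c2]
      by (simp add: left_diff_distrib Henstock_Kurzweil_Integration.integral_diff)
    also have "\<dots> = 0"
      using weak[OF s\<phi>] integral_by_parts_indefinite[OF v s\<phi>] v0 by (simp add: d\<phi> U_def)
    finally have 1: "integral {0..1} (\<lambda>t. (u t - U t) * (\<psi> t - k)) = 0" .
    \<comment> \<open>The terms outside the product of the two differences integrate to
      \<open>k * c - c * k\<close>, because \<open>c\<close> and \<open>k\<close> are the means of
      \<open>u - U\<close> and of \<open>\<psi>\<close>.\<close>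
    have "integral {0..1} (\<lambda>t. (u t - U t - c) * \<psi> t) =
        integral {0..1} (\<lambda>t. (u t - U t) * (\<psi> t - k) + (k * (u t - U t) - c * \<psi> t))"
      by (simp add: algebra_simps)
    also have "\<dots> = integral {0..1} (\<lambda>t. (u t - U t) * (\<psi> t - k)) +
        (integral {0..1} (\<lambda>t. k * (u t - U t)) - integral {0..1} (\<lambda>t. c * \<psi> t))"
    proof -
      have a: "(\<lambda>t. (u t - U t) * (\<psi> t - k)) integrable_on {0..1}"
        by (rule integrable_on_mult_continuous[OF uU c2])
      have b: "(\<lambda>t. k * (u t - U t)) integrable_on {0..1}"
        using uU integrable_cmul[of "\<lambda>t. u t - U t" "{0..1}" k] by (simp add: absolutely_integrable_on_def)
      have d: "(\<lambda>t. c * \<psi> t) integrable_on {0..1}"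
        by (intro integrable_continuous_real continuous_intros c\<psi>)
      show ?thesis
        using a b d by (simp only: Henstock_Kurzweil_Integration.integral_add
            Henstock_Kurzweil_Integration.integral_diff integrable_diff)
    qed
    also have "\<dots> = 0" unfolding 1 by (simp add: c_def[symmetric] k_def)
    finally show ?thesis .
  qed
  from fundamental_lemma_periodic[OF w zero] obtain Z
    where Z: "negligible Z" "\<And>t. t \<in> {0..1} - Z \<Longrightarrow> u t - U t - c = 0"
    by metis
  show ?thesis
  proof (rule that[OF v0 Z(1)])
    show "u t = c + integral {0..t} v" if "t \<in> {0..1} - Z" for t
      using Z(2)[OF that] by (simp add: U_def)
  qed
qed

text \<open>The derivative of a periodic test function has mean zero, so \<open>F\<close> may be
  replaced by \<open>F - F 0\<close>, the primitive starting at 0; its boundary term at 1 vanishes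
  by periodicity.\<close>

lemma weak_derivative_of_primitive:
  fixes F G :: "real \<Rightarrow> real"
  assumes F: "periodic_integrable F" and G: "periodic_integrable G"
    and prim: "\<And>s t. s \<le> t \<Longrightarrow> F t - F s = integral {s..t} G" and \<phi>: "smooth_periodic \<phi>"
  shows "integral {0..1} (\<lambda>t. G t * \<phi> t) = - integral {0..1} (\<lambda>t. F t * deriv \<phi> t)"
proof -
  have per: "F 1 = F 0" "\<phi> 1 = \<phi> 0"
    using F \<phi> unfolding periodic_integrable_def smooth_periodic_def by (metis add_0)+
  have ftc: "(deriv \<phi> has_integral (\<phi> 1 - \<phi> 0)) {0..1}"
    using smooth_periodic_DERIV[OF \<phi>]
    by (intro fundamental_theorem_of_calculus)
       (auto simp: has_real_derivative_iff_has_vector_derivative intro: has_vector_derivative_at_within)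
  have c: "continuous_on {0..1} (deriv \<phi>)"
    by (intro smooth_periodic_continuous_on smooth_periodic_deriv \<phi>)
  have iF: "(\<lambda>t. F t * deriv \<phi> t) integrable_on {0..1}"
    using F by (intro integrable_on_mult_continuous c) (auto simp: periodic_integrable_def)
  have "integral {0..1} (\<lambda>t. F t * deriv \<phi> t) =
      integral {0..1} (\<lambda>t. F t * deriv \<phi> t) - F 0 * integral {0..1} (deriv \<phi>)"
    using ftc per by (simp add: has_integral_iff)
  also have "\<dots> = integral {0..1} (\<lambda>t. (F t - F 0) * deriv \<phi> t)"
    using iF c integrable_continuous_real[of 0 1 "\<lambda>t. F 0 * deriv \<phi> t"]
    by (simp add: left_diff_distrib Henstock_Kurzweil_Integration.integral_diff continuous_intros)
  also have "\<dots> = integral {0..1} (\<lambda>t. integral {0..t} G * deriv \<phi> t)"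
    by (intro Henstock_Kurzweil_Integration.integral_cong) (auto simp: prim)
  also have "\<dots> = - integral {0..1} (\<lambda>t. G t * \<phi> t)"
    using integral_by_parts_indefinite[of G \<phi>] G \<phi> prim[of 0 1] per
    by (simp add: periodic_integrable_def)
  finally show ?thesis by simp
qed

section \<open>Splines and discrete norms\<close>

text \<open>Pascal's rule. This ties the iterated operator to the explicit binomial sum in
  \<open>discrete_deriv\<close>.\<close>

lemma bdiff_funpow_binomial:
  "(bdiff n ^^ r) f t =
    real n ^ r * (\<Sum>j=0..r. (-1) ^ j * real (r choose j) * f (t - real j / real n))"
proof (induction r arbitrary: t)
  case (Suc r)
  define a where "a j = (-1) ^ j * real (r choose j)" for j
  define g where "g j = f (t - real j / real n)" for j
  have shift: "f (t - 1 / real n - real j / real n) = g (Suc j)" for j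
    by (simp add: g_def add_divide_distrib algebra_simps)
  have "(\<Sum>j\<le>Suc r. (-1) ^ j * real (Suc r choose j) * g j) =
      g 0 + (\<Sum>j\<le>r. (-1) ^ Suc j * (real (r choose j) + real (r choose Suc j)) * g (Suc j))"
    by (simp add: sum.atMost_Suc_shift del: sum.atMost_Suc)
  also have "\<dots> = (g 0 + (\<Sum>j\<le>r. a (Suc j) * g (Suc j))) - (\<Sum>j\<le>r. a j * g (Suc j))"
    by (simp add: a_def algebra_simps sum.distrib sum_subtractf sum_negf)
  also have "g 0 + (\<Sum>j\<le>r. a (Suc j) * g (Suc j)) = (\<Sum>j\<le>Suc r. a j * g j)"
    by (simp add: sum.atMost_Suc_shift a_def del: sum.atMost_Suc)
  also have "\<dots> = (\<Sum>j\<le>r. a j * g j)" by (simp add: a_def)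
  finally have eq: "(\<Sum>j\<le>Suc r. (-1) ^ j * real (Suc r choose j) * g j) =
      (\<Sum>j\<le>r. a j * g j) - (\<Sum>j\<le>r. a j * g (Suc j))" .
  have "(bdiff n ^^ Suc r) f t = real n * ((bdiff n ^^ r) f t - (bdiff n ^^ r) f (t - 1 / real n))"
    by (simp add: bdiff_def)
  also have "\<dots> = real n ^ Suc r * ((\<Sum>j\<le>r. a j * g j) - (\<Sum>j\<le>r. a j * g (Suc j)))"
    unfolding Suc shift atLeast0AtMost by (simp add: a_def g_def algebra_simps)
  finally show ?case unfolding eq[symmetric] by (simp only: g_def atLeast0AtMost)
qed simp

lemma floor_shift_grid:
  assumes "n \<ge> (1::nat)"
  shows "\<lfloor>real n * (t - real j / real n)\<rfloor> = \<lfloor>real n * t\<rfloor> - int j"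
proof -
  have "real n * (t - real j / real n) = real n * t - of_int (int j)"
    using assms by (simp add: field_simps)
  then show ?thesis by (simp only: floor_diff_of_int)
qed

text \<open>Moving \<open>t\<close> by \<open>j / n\<close> moves the floor by exactly
  \<open>j\<close>, and the cyclic index takes care of the wrap-around. Constraints on
  \<open>p\<close> thereby become statements about the step function.\<close>

lemma bdiff_funpow_spline:
  assumes n: "n \<ge> 1"
  shows "(bdiff n ^^ r) (\<lambda>t. zero_order_spline n p t k) t =
    real n ^ r * discrete_deriv n r p (nat (\<lfloor>real n * t\<rfloor> mod int n)) k"
proof -
  have "(int (nat (\<lfloor>real n * t\<rfloor> mod int n)) - int j) mod int n = (\<lfloor>real n * t\<rfloor> - int j) mod int n" for j
    using n by (simp add: mod_diff_left_eq)
  then show ?thesis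
    by (simp only: bdiff_funpow_binomial discrete_deriv_def zero_order_spline_def
        floor_shift_grid[OF n] cyclic_nth_def)
qed

lemma step_function_has_integral:
  fixes c :: "nat \<Rightarrow> real"
  assumes n: "n \<ge> 1" and m: "m \<le> n"
  shows "((\<lambda>t. c (nat (\<lfloor>real n * t\<rfloor> mod int n))) has_integral (\<Sum>i<m. c i) / real n) {0..real m / real n}"
  using m
proof (induction m)
  case (Suc m)
  let ?h = "\<lambda>t. c (nat (\<lfloor>real n * t\<rfloor> mod int n))"
  have "((\<lambda>t. c m) has_integral c m * (real (Suc m) / n - real m / n)) {real m / n..real (Suc m) / n}"
    using has_integral_const_real[of "c m" "real m / n" "real (Suc m) / n"]
    by (simp add: divide_right_mono mult.commute)
  moreover have "c m * (real (Suc m) / n - real m / n) = c m / n"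
    by (simp add: diff_divide_distrib[symmetric])
  \<comment> \<open>At the right end of the cell the floor has already jumped, so that point is
    removed.\<close>
  moreover have "?h t = c m" if "t \<in> {real m / n..real (Suc m) / n} - {real (Suc m) / n}" for t
  proof -
    have "real m \<le> real n * t" "real n * t < real m + 1"
      using that n by (auto simp: field_simps)
    then have "\<lfloor>real n * t\<rfloor> = int m" by linarith
    then show ?thesis using Suc.prems by simp
  qed
  ultimately have "(?h has_integral c m / n) {real m / n..real (Suc m) / n}"
    using has_integral_spike_finite[of "{real (Suc m) / n}" "{real m / n..real (Suc m) / n}" ?h "\<lambda>_. c m"] by auto
  moreover have "(?h has_integral (\<Sum>i<m. c i) / n) {0..real m / n}"
    using Suc by simp
  ultimately have "(?h has_integral ((\<Sum>i<m. c i) / n + c m / n)) {0..real (Suc m) / n}"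
    by (intro has_integral_combine[of 0 "real m / n"]) (auto simp: divide_right_mono)
  then show ?case by (simp add: add_divide_distrib)
qed (simp add: has_integral_refl)

lemma step_function_periodic_integrable:
  assumes n: "n \<ge> 1"
  shows "periodic_integrable (\<lambda>t. c (nat (\<lfloor>real n * t\<rfloor> mod int n)))" (is "periodic_integrable ?h")
    and "integral {0..1} (\<lambda>t. c (nat (\<lfloor>real n * t\<rfloor> mod int n))) = (\<Sum>i<n. c i) / real n"
proof -
  have int: "((\<lambda>t. b (nat (\<lfloor>real n * t\<rfloor> mod int n))) has_integral (\<Sum>i<n. b i) / real n) {0..1}"
    for b :: "nat \<Rightarrow> real"
    using step_function_has_integral[OF n order.refl, of b] n by simp
  from int[of c] show "integral {0..1} ?h = (\<Sum>i<n. c i) / real n" by (rule integral_unique)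
  show "periodic_integrable ?h"
  proof (rule periodic_integrableI)
    have "real n * (t + 1) = real n * t + of_int (int n)" for t
      by (simp add: distrib_left)
    then show "?h (t + 1) = ?h t" for t by (simp only: floor_add_int[symmetric] mod_add_self2)
    show "?h absolutely_integrable_on {0..1}"
      using int[of c] int[of "\<lambda>i. \<bar>c i\<bar>"]
      by (auto simp: absolutely_integrable_on_def integrable_on_def)
  qed
qed

section \<open>Comparison of norms, integrals and distances\<close>

lemma powr_inverse_le_iff:
  fixes y a q :: real
  assumes "0 \<le> y" "0 \<le> a" "q \<ge> 1"
  shows "y powr (1 / q) \<le> a \<longleftrightarrow> y \<le> a powr q"
proof
  assume "y powr (1 / q) \<le> a"
  then have "(y powr (1 / q)) powr q \<le> a powr q" using assms by (intro powr_mono2) auto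
  then show "y \<le> a powr q" using assms by (simp add: powr_powr)
next
  assume "y \<le> a powr q"
  then have "y powr (1 / q) \<le> (a powr q) powr (1 / q)" using assms by (intro powr_mono2) auto
  then show "y powr (1 / q) \<le> a" using assms by (simp add: powr_powr)
qed

text \<open>Puts the discrete constraint into the form of a \<open>q\<close>-th power mean over grid
  points, the counterpart of the integral condition in \<open>Lq_norm_le_iff\<close>.\<close>

lemma discrete_norm_le_iff:
  assumes N: "norm_on_Rd d N" and q: "q \<ge> (1::real)" and n: "n \<ge> 1" and a: "a \<ge> 0"
    and p: "\<And>i. i < n \<Longrightarrow> p i \<in> Rd d"
  shows "real n ^ r * lq_norm N q n (discrete_deriv n r p) \<le> a \<longleftrightarrow>
    (\<Sum>i<n. N (\<lambda>k. (bdiff n ^^ r) (\<lambda>t. zero_order_spline n p t k) (real i / real n)) powr q) / real n \<le> a powr q"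
proof -
  have dR: "discrete_deriv n r p i \<in> Rd d" for i
  proof -
    have "cyclic_nth n p j \<in> Rd d" for j
      unfolding cyclic_nth_def using n by (intro p) (simp add: nat_less_iff)
    then show ?thesis by (simp add: discrete_deriv_def Rd_def)
  qed
  have "N (\<lambda>k. (bdiff n ^^ r) (\<lambda>t. zero_order_spline n p t k) (real i / real n)) =
      real n ^ r * N (discrete_deriv n r p i)" if "i < n" for i
    using n that N_scale[OF N dR, of "real n ^ r"] by (simp add: bdiff_funpow_spline)
  then have "(\<Sum>i<n. N (\<lambda>k. (bdiff n ^^ r) (\<lambda>t. zero_order_spline n p t k) (real i / real n)) powr q) / real n
      = (real n ^ r) powr q * (1 / real n * (\<Sum>i<n. N (discrete_deriv n r p i) powr q))"
    using N_nonneg[OF N dR] by (simp add: powr_mult sum_distrib_left sum_divide_distrib)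
  moreover have "((real n ^ r) powr q * (1 / real n * (\<Sum>i<n. N (discrete_deriv n r p i) powr q))) powr (1 / q) =
     real n ^ r * lq_norm N q n (discrete_deriv n r p)"
    using q n by (subst powr_mult) (auto simp: lq_norm_def powr_powr intro!: sum_nonneg divide_nonneg_nonneg)
  moreover have "0 \<le> (real n ^ r) powr q * (1 / real n * (\<Sum>i<n. N (discrete_deriv n r p i) powr q))"
    by (intro sum_nonneg mult_nonneg_nonneg) auto
  ultimately show ?thesis using powr_inverse_le_iff[OF _ a q] by metis
qed

text \<open>The tangent of \<open>y powr q\<close> at \<open>a\<close>, integrated over an interval
  of length 1, has value at most \<open>a powr q\<close>; its slope is positive, so the mean of
  \<open>h\<close> cannot exceed \<open>a\<close>.\<close>

lemma L1_le_of_powr: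
  fixes h :: "real \<Rightarrow> real"
  assumes h: "\<And>t. 0 \<le> h t" and q: "q \<ge> 1" and a: "a > 0"
    and int: "periodic_integrable (\<lambda>t. h t powr q)" and le: "integral {0..1} (\<lambda>t. h t powr q) \<le> a powr q"
  shows "periodic_integrable h" "integral {0..1} h \<le> a"
proof -
  have hq: "h t = (h t powr q) powr (1 / q)" for t
    using h[of t] q by (simp add: powr_powr)
  have inth: "(\<lambda>t. h t powr q) integrable_on {0..1}" by (rule periodic_integrable_integrable_on[OF int])
  have "(\<lambda>t. (h t powr q) powr (1 / q)) \<in> borel_measurable (lebesgue_on {0..1})"
    using integrable_imp_measurable[OF inth] by measurable
  then have meas: "h \<in> borel_measurable (lebesgue_on {0..1})"
    by (simp only: hq[symmetric])
  have "h integrable_on {0..1}"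
  proof (rule measurable_bounded_by_integrable_imp_integrable[OF meas])
    show "(\<lambda>t. 1 + h t powr q) integrable_on {0..1}"
      using inth by (intro integrable_add) auto
    show "norm (h t) \<le> 1 + h t powr q" for t
    proof (cases "h t \<le> 1")
      case False
      then have "h t powr 1 \<le> h t powr q" using q by (intro powr_mono) auto
      then show ?thesis using False h[of t] by simp
    qed (use h in \<open>auto intro: order_trans[of _ 1]\<close>)
  qed simp
  then have abs: "h absolutely_integrable_on {0..1}"
    using h by (intro nonnegative_absolutely_integrable_1) auto
  show per: "periodic_integrable h"
  proof (rule periodic_integrableI[OF _ abs])
    show "h (t + 1) = h t" for t
      using int by (subst (1 2) hq) (simp add: periodic_integrable_def)
  qed
  have "a powr q + q * a powr (q - 1) * (integral {0..1} h - a) =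
      integral {0..1} (\<lambda>t. (a powr q - q * a powr (q - 1) * a) + q * a powr (q - 1) * h t)"
    using integrable_cmul[OF periodic_integrable_integrable_on[OF per, of 0 1], of "q * a powr (q - 1)"]
    by (subst Henstock_Kurzweil_Integration.integral_add) (auto simp: algebra_simps)
  also have "\<dots> \<le> integral {0..1} (\<lambda>t. h t powr q)"
    using powr_above_tangent[OF q a h]
    by (intro integral_le periodic_integrable_integrable_on int periodic_integrable_add
        periodic_integrable_const periodic_integrable_cmult per) (auto simp: algebra_simps)
  finally have "q * a powr (q - 1) * (integral {0..1} h - a) \<le> 0" using le by simp
  moreover have "q * a powr (q - 1) > 0" using q a by simp
  ultimately show "integral {0..1} h \<le> a"
    by (meson diff_gt_0_iff_gt mult_pos_pos not_le)
qed

lemma norm_integral_le: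
  assumes N: "norm_on_Rd d N" and g: "\<And>t. g t \<in> Rd d" "\<And>k. (\<lambda>t. g t k) integrable_on {a..b}"
    and Ng: "(\<lambda>t. N (g t)) integrable_on {a..b::real}"
  shows "N (\<lambda>k. integral {a..b} (\<lambda>t. g t k)) \<le> integral {a..b} (\<lambda>t. N (g t))"
proof -
  have "(\<lambda>k. integral {a..b} (\<lambda>t. g t k)) \<in> Rd d"
    using g(1) by (simp add: Rd_def)
  then obtain c where c: "N (\<lambda>k. integral {a..b} (\<lambda>t. g t k)) = (\<Sum>k<d. c k * integral {a..b} (\<lambda>t. g t k))"
    "\<And>y. y \<in> Rd d \<Longrightarrow> (\<Sum>k<d. c k * y k) \<le> N y"
    by (rule norming_functional[OF N]) (rule that; assumption)
  have int: "(\<lambda>t. c k * g t k) integrable_on {a..b}" for k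
    using integrable_cmul[OF g(2), of "c k" k] by simp
  have "(\<Sum>k<d. c k * integral {a..b} (\<lambda>t. g t k)) = integral {a..b} (\<lambda>t. \<Sum>k<d. c k * g t k)"
    by (subst Henstock_Kurzweil_Integration.integral_sum) (auto intro: int)
  also have "\<dots> \<le> integral {a..b} (\<lambda>t. N (g t))"
    by (intro integral_le integrable_sum Ng c(2) g(1)) (auto intro: int)
  finally show ?thesis by (simp add: c(1))
qed

text \<open>The case \<open>q = 1\<close> of Jensen, applied to \<open>z - f\<close> with a constant
  majorant; averaging fixes the constant vector \<open>z\<close>.\<close>

lemma norm_diff_steklov_le:
  assumes N: "norm_on_Rd d N" and n: "n \<ge> 1" and z: "z \<in> Rd d"
    and f: "\<And>t. f t \<in> Rd d" "\<And>k. periodic_integrable (\<lambda>t. f t k)"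
    and M: "\<And>t. t \<in> {x - 1 / real n..x} \<Longrightarrow> N (\<lambda>k. z k - f t k) \<le> M"
  shows "N (\<lambda>k. z k - steklov n (\<lambda>t. f t k) x) \<le> M"
proof -
  have R: "(\<lambda>k. z k - f t k) \<in> Rd d" for t by (rule Rd_diff[OF z f(1)])
  have "N (\<lambda>k. steklov n (\<lambda>t. z k - f t k) x) powr 1 \<le> steklov n (\<lambda>_. M) x"
    by (rule norm_steklov_powr_le[OF N order.refl n R])
       (use M N_nonneg[OF N R] f(2) in \<open>auto intro: periodic_integrable_diff periodic_integrable_const\<close>)
  moreover have "steklov n (\<lambda>t. z k - f t k) x = z k - steklov n (\<lambda>t. f t k) x" for k
    by (simp add: steklov_diff periodic_integrable_const f(2) steklov_const[OF n])
  moreover have "(\<lambda>k. z k - steklov n (\<lambda>t. f t k) x) \<in> Rd d"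
    using z f(1) by (simp add: Rd_def steklov_def)
  ultimately show ?thesis
    using N_nonneg[OF N] by (simp add: steklov_const[OF n])
qed

lemma curve_dist_le:
  assumes W: "periodic_integrable W" "\<And>t. 0 \<le> W t" "integral {0..1} W \<le> C"
    and Z: "negligible Z" and le: "\<And>t. t \<in> {0..1} - Z \<Longrightarrow> N (\<lambda>k. f t k - g t k) \<le> W t"
  shows "curve_dist N f g \<le> ennreal C"
proof -
  have int: "integrable (lebesgue_on {0..1}) W"
    using W(1) by (intro absolutely_integrable_imp_integrable) (auto simp: periodic_integrable_def)
  have "AE t in lebesgue_on {0..1}. t \<notin> Z"
    using Z by (auto simp: AE_restrict_space_iff negligible_iff_null_sets intro: AE_mp[OF AE_not_in])
  then have "AE t in lebesgue_on {0..1}. ennreal (N (\<lambda>k. f t k - g t k)) \<le> ennreal (W t)"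
    using AE_space by eventually_elim (use le in \<open>auto intro: ennreal_leI\<close>)
  then have "curve_dist N f g \<le> (\<integral>\<^sup>+ t. ennreal (W t) \<partial>lebesgue_on {0..1})"
    unfolding curve_dist_def by (rule nn_integral_mono_AE)
  also have "\<dots> = ennreal (integral {0..1} W)"
    using nn_integral_eq_integral[OF int] W(2) lebesgue_integral_eq_integral[OF int] by simp
  also have "\<dots> \<le> ennreal C" using W(3) by (rule ennreal_leI)
  finally show ?thesis .
qed

section \<open>Translation of the function spaces to scalar periodic functions, and
  representatives\<close>

lemma integrable_lebesgue_on_unit_iff:
  fixes h :: "real \<Rightarrow> real"
  shows "integrable (lebesgue_on {0..1}) h \<longleftrightarrow> h absolutely_integrable_on {0..1}"
  by (simp add: integrable_restrict_space set_integrable_def)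

lemma periodic_integrable_iff:
  "periodic_integrable f \<longleftrightarrow> (\<forall>t. f (t + 1) = f t) \<and> integrable (lebesgue_on {0..1}) f"
  unfolding integrable_lebesgue_on_unit_iff
  by (metis periodic_integrableI periodic_integrable_def)

lemma periodic_L1_iff:
  "f \<in> periodic_L1 d \<longleftrightarrow> (\<forall>t. f t \<in> Rd d) \<and> (\<forall>k. periodic_integrable (\<lambda>t. f t k))"
proof -
  have "periodic_integrable (\<lambda>t. f t k)" if "\<forall>t. f t \<in> Rd d" "k \<ge> d" for k
  proof -
    have "(\<lambda>t. f t k) = (\<lambda>t. 0)" using that by (auto simp: Rd_def)
    then show ?thesis by (simp add: periodic_integrable_const)
  qed
  then show ?thesis
    unfolding periodic_L1_def periodic_integrable_iff fun_eq_iff by (auto simp: not_less) (meson not_less)+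
qed

lemma Lq_norm_le_iff:
  assumes per: "\<And>t. g (t + 1) = g t" and q: "q \<ge> 1" and a: "a \<ge> 0"
  shows "Lq_norm_le N q g a \<longleftrightarrow> periodic_integrable (\<lambda>t. N (g t) powr q) \<and>
    integral {0..1} (\<lambda>t. N (g t) powr q) \<le> a powr q"
proof -
  have "integral\<^sup>L (lebesgue_on {0..1}) (\<lambda>t. N (g t) powr q) powr (1 / q) \<le> a \<longleftrightarrow>
      integral {0..1} (\<lambda>t. N (g t) powr q) \<le> a powr q"
    if int: "integrable (lebesgue_on {0..1}) (\<lambda>t. N (g t) powr q)"
    unfolding lebesgue_integral_eq_integral[OF int, simplified]
    using q a integrable_on_lebesgue_on[OF int]
    by (intro powr_inverse_le_iff) (auto intro: integral_nonneg)
  then show ?thesis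
    by (auto simp: Lq_norm_le_def periodic_integrable_iff per)
qed

lemma periodic_weak_deriv_iff:
  assumes f: "\<And>k. periodic_integrable (\<lambda>t. f t k)" and g: "\<And>k. periodic_integrable (\<lambda>t. g t k)"
  shows "periodic_weak_deriv d r f g \<longleftrightarrow> (\<forall>\<phi>. smooth_periodic \<phi> \<longrightarrow> (\<forall>k<d.
    integral {0..1} (\<lambda>t. g t k * \<phi> t) = (-1) ^ r * integral {0..1} (\<lambda>t. f t k * (deriv ^^ r) \<phi> t)))"
proof -
  have "(LINT t|lebesgue_on {0..1}. h t * \<phi> t) = integral {0..1} (\<lambda>t. h t * \<phi> t)"
    if "periodic_integrable h" "smooth_periodic \<phi>" for h \<phi> :: "real \<Rightarrow> real"
    using that
    by (intro lebesgue_integral_eq_integral absolutely_integrable_imp_integrable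
        absolutely_integrable_mult_continuous smooth_periodic_continuous_on) (auto simp: periodic_integrable_def)
  then show ?thesis
    using f g by (simp add: periodic_weak_deriv_def smooth_periodic_higher_deriv)
qed

text \<open>Along a chain in which each function is a primitive of the next, the derivatives pass to
  the test function one at a time.\<close>

lemma periodic_weak_deriv_of_primitives:
  assumes F: "\<And>r k. r \<le> m \<Longrightarrow> periodic_integrable (\<lambda>t. F r t k)"
    and prim: "\<And>r k s t. r < m \<Longrightarrow> s \<le> t \<Longrightarrow> F r t k - F r s k = integral {s..t} (\<lambda>x. F (Suc r) x k)"
    and r: "r \<le> m"
  shows "periodic_weak_deriv d r (F 0) (F r)"
proof -
  have "integral {0..1} (\<lambda>t. F r t k * \<phi> t) = (-1) ^ r * integral {0..1} (\<lambda>t. F 0 t k * (deriv ^^ r) \<phi> t)"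
    if "smooth_periodic \<phi>" for \<phi> k
    using r that
  proof (induction r arbitrary: \<phi>)
    case (Suc r)
    have "integral {0..1} (\<lambda>t. F (Suc r) t k * \<phi> t) = - integral {0..1} (\<lambda>t. F r t k * deriv \<phi> t)"
      using Suc.prems by (intro weak_derivative_of_primitive F prim) auto
    also have "integral {0..1} (\<lambda>t. F r t k * deriv \<phi> t) =
        (-1) ^ r * integral {0..1} (\<lambda>t. F 0 t k * (deriv ^^ r) (deriv \<phi>) t)"
      using Suc.prems by (intro Suc.IH smooth_periodic_deriv) auto
    finally show ?case by (simp only: funpow_Suc_right o_apply) simp
  qed simp
  then show ?thesis
    using r by (subst periodic_weak_deriv_iff) (auto intro: F)
qed

lemma periodic_integrable_abs: "periodic_integrable f \<Longrightarrow> periodic_integrable (\<lambda>t. \<bar>f t\<bar>)"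
  by (auto simp: periodic_integrable_def absolutely_integrable_on_def)

text \<open>The window is no longer than a period, over which the difference has vanishing L1 norm.
  Averages therefore cannot tell a weak derivative from its continuous representative.\<close>

lemma steklov_cong_negligible:
  assumes n: "n \<ge> 1" and u: "periodic_integrable u" and v: "periodic_integrable v"
    and Z: "negligible Z" "\<And>t. t \<in> {0..1} - Z \<Longrightarrow> u t = v t"
  shows "steklov n u = steklov n v"
proof
  fix x
  define w where "w = (\<lambda>t. u t - v t)"
  have w: "periodic_integrable w" unfolding w_def by (rule periodic_integrable_diff[OF u v])
  note aw = periodic_integrable_abs[OF w]
  have h: "1 / real n \<le> 1" using n by simp
  have "\<bar>integral {x - 1 / n..x} w\<bar> \<le> integral {x - 1 / n..x} (\<lambda>t. \<bar>w t\<bar>)"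
    using integral_norm_bound_integral[of w "{x - 1 / n..x}" "\<lambda>t. \<bar>w t\<bar>"] w aw by auto
  also have "\<dots> \<le> integral {x - 1..x} (\<lambda>t. \<bar>w t\<bar>)"
    using h by (intro integral_subset_le) (auto intro: aw)
  also have "\<dots> = integral {0..1} (\<lambda>t. \<bar>w t\<bar>)"
    using integral_over_period[OF aw, of "x - 1"] by simp
  also have "\<dots> = integral {0..1} (\<lambda>t::real. 0)"
    by (rule Henstock_Kurzweil_Integration.integral_spike[OF Z(1)]) (simp add: w_def Z(2))
  finally have "integral {x - 1 / n..x} w = 0" by simp
  then show "steklov n u x = steklov n v x"
    using u v by (simp add: steklov_def w_def Henstock_Kurzweil_Integration.integral_diff periodic_integrable_integrable_on)
qed

text \<open>Extends the representative from the unit interval to the line; it is periodic because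
  \<open>v\<close> has mean zero.\<close>

lemma weak_derivative_primitive:
  assumes u: "periodic_integrable u" and v: "periodic_integrable v"
    and weak: "\<And>\<phi>. smooth_periodic \<phi> \<Longrightarrow>
      integral {0..1} (\<lambda>t. v t * \<phi> t) = - integral {0..1} (\<lambda>t. u t * deriv \<phi> t)"
  obtains U Z where "periodic_integrable U" "\<And>s t. s \<le> t \<Longrightarrow> U t - U s = integral {s..t} v"
    "negligible Z" "\<And>t. t \<in> {0..1} - Z \<Longrightarrow> u t = U t"
proof -
  obtain c Z where v0: "integral {0..1} v = 0" and Z: "negligible Z"
    "\<And>t. t \<in> {0..1} - Z \<Longrightarrow> u t = c + integral {0..t} v"
  proof (rule du_Bois_Reymond_periodic[of u v])
    show "u absolutely_integrable_on {0..1}" "v absolutely_integrable_on {0..1}"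
      using u v by (auto simp: periodic_integrable_def)
  qed (use weak in auto)
  define U where "U t = c + (if 0 \<le> t then integral {0..t} v else - integral {t..0} v)" for t
  have inc: "U t - U s = integral {s..t} v" if "s \<le> t" for s t
    using that periodic_integral_combine[OF v, of 0 s t] periodic_integral_combine[OF v, of s 0 t]
      periodic_integral_combine[OF v, of s t 0]
    by (auto simp: U_def)
  have "continuous_on {a..b} U" for a b
  proof -
    have "continuous_on {a..b} (\<lambda>t. U a + integral {a..t} v)"
      using v by (intro continuous_intros indefinite_integral_continuous_1) auto
    moreover have "U a + integral {a..t} v = U t" if "t \<in> {a..b}" for t
      using inc[of a t] that by simp
    ultimately show ?thesis by (subst continuous_on_cong[OF refl]) auto
  qed
  moreover have "U (t + 1) = U t" for t
    using inc[of t "t + 1"] integral_over_period[OF v, of t] v0 by simp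
  ultimately have "periodic_integrable U"
    by (intro periodic_integrableI absolutely_integrable_continuous_real)
  then show ?thesis
  proof (rule that)
    show "u t = U t" if "t \<in> {0..1} - Z" for t
      using Z(2)[OF that] that by (simp add: U_def)
  qed (use inc Z in auto)
qed

text \<open>Differences of a spline are constant on grid cells, so any \<open>H\<close> composed
  with them is again a step function. It is applied with coordinates and with
  \<open>N v powr q\<close>.\<close>

lemma spline_bdiff_step:
  fixes H :: "vect \<Rightarrow> real"
  assumes n: "n \<ge> 1"
  defines "D \<equiv> (\<lambda>r p t k. (bdiff n ^^ r) (\<lambda>t. zero_order_spline n p t k) t)"
  shows "periodic_integrable (\<lambda>t. H (D r p t))"
    and "integral {0..1} (\<lambda>t. H (D r p t)) = (\<Sum>i<n. H (D r p (real i / real n))) / real n"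
proof -
  define c where "c i = H (\<lambda>k. real n ^ r * discrete_deriv n r p i k)" for i
  have D: "(\<lambda>t. H (D r p t)) = (\<lambda>t. c (nat (\<lfloor>real n * t\<rfloor> mod int n)))"
    by (simp add: D_def c_def bdiff_funpow_spline[OF n])
  have "H (D r p (real i / real n)) = c i" if "i < n" for i
    using that n by (simp add: D_def c_def bdiff_funpow_spline[OF n])
  with step_function_periodic_integrable[OF n, of c]
  show "periodic_integrable (\<lambda>t. H (D r p t))"
    "integral {0..1} (\<lambda>t. H (D r p t)) = (\<Sum>i<n. H (D r p (real i / real n))) / real n"
    unfolding D by simp_all
qed

lemma zero_order_spline_Rd:
  assumes n: "n \<ge> 1" and p: "\<And>i. i < n \<Longrightarrow> p i \<in> Rd d"
  shows "zero_order_spline n p t \<in> Rd d"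
  unfolding zero_order_spline_def cyclic_nth_def using n by (intro p) (simp add: nat_less_iff)

text \<open>\<open>j\<close> averages at \<open>x\<close> involve values of the spline only on
  \<open>[x - j/n, x]\<close>, each separated from \<open>t\<close> by at most \<open>a + j\<close>
  jumps of size \<open>b / n\<close>. The number \<open>a\<close> is kept general because one
  average moves the point back by up to one cell.\<close>

lemma norm_spline_diff_steklov_funpow_le:
  assumes N: "norm_on_Rd d N" and n: "n \<ge> 1" and p: "\<And>i. i < n \<Longrightarrow> p i \<in> Rd d"
  defines "s \<equiv> zero_order_spline n p"
  defines "b \<equiv> (\<lambda>t. N (\<lambda>k. bdiff n (\<lambda>t. s t k) t))"
  assumes x: "x \<le> t" "t - real a / real n \<le> x"
  shows "N (\<lambda>k. s t k - (steklov n ^^ j) (\<lambda>t. s t k) x) \<le> (\<Sum>l<a + j. b (t - real l / real n)) / real n"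
proof -
  have sR: "s t \<in> Rd d" for t unfolding s_def by (rule zero_order_spline_Rd[OF n p])
  have b: "b y = real n * N (\<lambda>k. s y k - s (y - 1 / real n) k)" for y
    using N_scale[OF N Rd_diff[OF sR sR], of "real n" y "y - 1 / real n"] by (simp add: b_def bdiff_def)
  then have b0: "b y \<ge> 0" for y
    using N_nonneg[OF N Rd_diff[OF sR sR]] by simp
  show ?thesis
    using x
  proof (induction j arbitrary: a x)
    case 0
    \<comment> \<open>The number of grid points passed between \<open>x\<close> and
      \<open>t\<close>; it is at most \<open>a\<close>, and the jumps over them telescope.\<close>
    define i where "i = nat (\<lfloor>real n * t\<rfloor> - \<lfloor>real n * x\<rfloor>)"
    have le: "\<lfloor>real n * x\<rfloor> \<le> \<lfloor>real n * t\<rfloor>" using 0 by (intro floor_mono mult_left_mono) auto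
    have "\<lfloor>real n * t\<rfloor> - int a \<le> \<lfloor>real n * x\<rfloor>"
      unfolding floor_shift_grid[OF n, symmetric] using 0 by (intro floor_mono mult_left_mono) auto
    then have ia: "i \<le> a" by (simp add: i_def)
    have "\<lfloor>real n * x\<rfloor> = \<lfloor>real n * t\<rfloor> - int i" using le by (simp add: i_def)
    then have sx: "s x = s (t - real i / real n)"
      unfolding s_def zero_order_spline_def floor_shift_grid[OF n] by simp
    have "N (\<lambda>k. s t k - s (t - real i / real n) k) \<le> (\<Sum>l<i. b (t - real l / real n) / real n)" for i
    proof (induction i)
      case (Suc i)
      have e: "t - real (Suc i) / real n = t - real i / real n - 1 / real n"
        by (simp add: add_divide_distrib)
      have "N (\<lambda>k. s t k - s (t - real (Suc i) / real n) k) \<le>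
          N (\<lambda>k. s t k - s (t - real i / real n) k) +
          N (\<lambda>k. s (t - real i / real n) k - s (t - real (Suc i) / real n) k)"
        by (rule N_triangle_diff[OF N sR sR sR])
      also have "N (\<lambda>k. s (t - real i / real n) k - s (t - real (Suc i) / real n) k) =
          b (t - real i / real n) / real n"
        using n unfolding e b by simp
      finally show ?case using Suc by simp
    qed (simp add: N_zero[OF N])
    from this[of i] have "N (\<lambda>k. s t k - s x k) \<le> (\<Sum>l<i. b (t - real l / real n) / real n)"
      by (simp add: sx)
    also have "\<dots> \<le> (\<Sum>l<a. b (t - real l / real n) / real n)"
      using ia b0 by (intro sum_mono2) auto
    finally show ?case by (simp add: sum_divide_distrib)
  next
    case (Suc j)
    have pi: "periodic_integrable (\<lambda>t. s t k)" for k
      using spline_bdiff_step(1)[OF n, of "\<lambda>v. v k" 0 p] by (simp add: s_def)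
    show ?case
      unfolding funpow.simps o_apply
    proof (rule norm_diff_steklov_le[OF N n sR, where f = "\<lambda>t k. (steklov n ^^ j) (\<lambda>t. s t k) t"])
      show "(\<lambda>k. (steklov n ^^ j) (\<lambda>t. s t k) y) \<in> Rd d" for y by (rule steklov_funpow_Rd[OF sR])
      show "periodic_integrable (\<lambda>t. (steklov n ^^ j) (\<lambda>t. s t k) t)" for k
        by (rule steklov_funpow_periodic_integrable[OF pi])
      fix y assume y: "y \<in> {x - 1 / real n..x}"
      have "N (\<lambda>k. s t k - (steklov n ^^ j) (\<lambda>t. s t k) y) \<le>
          (\<Sum>l<Suc a + j. b (t - real l / real n)) / real n"
        using Suc.prems y by (intro Suc.IH) (auto simp: add_divide_distrib)
      then show "N (\<lambda>k. s t k - (steklov n ^^ j) (\<lambda>t. s t k) y) \<le>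
          (\<Sum>l<a + Suc j. b (t - real l / real n)) / real n" by simp
    qed
  qed
qed

section \<open>The two inclusions up to \<open>O(1/n)\<close>\<close>

lemma spline_near_sobolev:
  assumes N: "norm_on_Rd d N" and q: "q \<ge> (1::real)" and n: "n \<ge> 1" and m: "m \<ge> 1"
    and \<alpha>: "\<And>r. r \<le> m \<Longrightarrow> \<alpha> r > 0"
    and g: "g \<in> spline_multiball d N m q n \<alpha>"
  shows "\<exists>f\<in>sobolev_multiball d N m q \<alpha>. curve_dist N g f \<le> ennreal (real m * \<alpha> 1 / real n)"
proof -
  obtain p where g_def: "g = zero_order_spline n p" and p: "\<And>i. i < n \<Longrightarrow> p i \<in> Rd d"
    and pn: "\<And>r. r \<le> m \<Longrightarrow> real n ^ r * lq_norm N q n (discrete_deriv n r p) \<le> \<alpha> r"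
    using g by (auto simp: spline_multiball_def discrete_multiball_def)
  define D where "D = (\<lambda>r t k. (bdiff n ^^ r) (\<lambda>t. g t k) t)"
  have gR: "g t \<in> Rd d" for t unfolding g_def by (rule zero_order_spline_Rd[OF n p])
  have DR: "D r t \<in> Rd d" for r t
  proof -
    have "(bdiff n ^^ r) (\<lambda>t. 0) = (\<lambda>t. 0)" by (induction r) (auto simp: bdiff_def)
    then show ?thesis using gR by (simp add: D_def Rd_def)
  qed
  note step = spline_bdiff_step[OF n, where p = p, folded g_def]
  have Dpi: "periodic_integrable (\<lambda>t. D r t k)" for r k
    using step(1)[where H = "\<lambda>v. v k" and r = r] by (simp add: D_def)
  have K: "periodic_integrable (\<lambda>t. N (D r t) powr q)" for r
    using step(1)[where H = "\<lambda>v. N v powr q" and r = r] by (simp add: D_def)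
  have Kle: "integral {0..1} (\<lambda>t. N (D r t) powr q) \<le> \<alpha> r powr q" if r: "r \<le> m" for r
  proof -
    have "integral {0..1} (\<lambda>t. N (D r t) powr q) = (\<Sum>i<n. N (D r (real i / real n)) powr q) / real n"
      using step(2)[where H = "\<lambda>v. N v powr q" and r = r] by (simp add: D_def)
    also have "\<dots> \<le> \<alpha> r powr q"
      using discrete_norm_le_iff[OF N q n less_imp_le[OF \<alpha>[OF r]] p, where r = r] pn[OF r]
      by (simp add: D_def g_def)
    finally show ?thesis .
  qed
  \<comment> \<open>Every remaining average pays for one more weak derivative. At
    \<open>r = m\<close> none remains and \<open>F m\<close> is the step function
    \<open>D m\<close>.\<close>
  define F where "F = (\<lambda>r t k. (steklov n ^^ (m - r)) (\<lambda>t. D r t k) t)"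
  have FR: "F r t \<in> Rd d" for r t unfolding F_def by (rule steklov_funpow_Rd[OF DR])
  have Fpi: "periodic_integrable (\<lambda>t. F r t k)" for r k
    unfolding F_def by (rule steklov_funpow_periodic_integrable[OF Dpi])
  have prim: "F r t k - F r s k = integral {s..t} (\<lambda>x. F (Suc r) x k)"
    if "r < m" "s \<le> t" for r k s t
  proof -
    let ?j = "m - Suc r"
    have eq: "m - r = Suc ?j" using that by simp
    have pj: "periodic_integrable ((steklov n ^^ ?j) (\<lambda>t. D r t k))"
      by (rule steklov_funpow_periodic_integrable[OF Dpi])
    have "bdiff n (\<lambda>t. D r t k) = (\<lambda>t. D (Suc r) t k)" by (simp add: D_def)
    then have "bdiff n ((steklov n ^^ ?j) (\<lambda>t. D r t k)) = (\<lambda>x. F (Suc r) x k)"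
      by (simp add: bdiff_steklov_funpow[OF Dpi] F_def)
    with steklov_increment[OF pj \<open>s \<le> t\<close>, of n] show ?thesis
      unfolding F_def eq by simp
  qed
  have FL1: "F r \<in> periodic_L1 d" for r using FR Fpi by (simp add: periodic_L1_iff)
  have per: "F r (t + 1) = F r t" for r t
    using Fpi by (auto simp: periodic_integrable_def)
  have norm: "Lq_norm_le N q (F r) (\<alpha> r)" if r: "r \<le> m" for r
  proof -
    \<comment> \<open>Averaging the \<open>q\<close>-th power of the norm keeps its integral, so the
      bound \<alpha> is inherited without loss.\<close>
    let ?K = "(steklov n ^^ (m - r)) (\<lambda>t. N (D r t) powr q)"
    have Kpi: "periodic_integrable ?K" by (rule steklov_funpow_periodic_integrable[OF K])
    have le: "N (F r t) powr q \<le> ?K t" for t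
      unfolding F_def by (rule norm_steklov_funpow_powr_le[OF N q n DR Dpi K order.refl])
    have "(\<lambda>t. N (F r t)) \<in> borel_measurable (lebesgue_on {0..1})"
      using Fpi by (intro norm_comp_measurable[OF N FR] integrable_imp_measurable) auto
    then have "(\<lambda>t. N (F r t) powr q) \<in> borel_measurable (lebesgue_on {0..1})"
      by measurable
    then have int: "(\<lambda>t. N (F r t) powr q) integrable_on {0..1}"
      by (rule measurable_bounded_by_integrable_imp_integrable[where g = ?K]) (use Kpi le in auto)
    have pi: "periodic_integrable (\<lambda>t. N (F r t) powr q)"
      using int per by (intro periodic_integrableI nonnegative_absolutely_integrable_1) auto
    have "integral {0..1} (\<lambda>t. N (F r t) powr q) \<le> integral {0..1} ?K"
      by (intro integral_le int le periodic_integrable_integrable_on Kpi)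
    also have "\<dots> \<le> \<alpha> r powr q"
      using Kle[OF r] integral_steklov_funpow[OF n K] by simp
    finally show ?thesis
      using pi \<alpha>[OF r] by (subst Lq_norm_le_iff[where g = "F r", OF per q]) auto
  qed
  have mem: "F 0 \<in> sobolev_multiball d N m q \<alpha>"
    unfolding sobolev_multiball_def using FL1 norm periodic_weak_deriv_of_primitives[where F = F and m = m, OF Fpi prim]
    by blast
  define b where "b = (\<lambda>t. N (D 1 t))"
  have bpos: "b t \<ge> 0" for t unfolding b_def by (rule N_nonneg[OF N DR])
  have b: "periodic_integrable b" "integral {0..1} b \<le> \<alpha> 1"
    using L1_le_of_powr[where h = b, OF bpos q \<alpha>[OF m]] K[of 1] Kle[OF m] by (simp_all add: b_def)
  \<comment> \<open>The \<open>m\<close> jumps behind \<open>t\<close>. Each translate of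
    \<open>b\<close> has integral at most \<alpha> at index 1, which yields the factor
    \<open>m / n\<close>.\<close>
  define W where "W = (\<lambda>t. (\<Sum>l<m. b (t + - (real l / real n))) / real n)"
  have W: "periodic_integrable W"
    unfolding W_def divide_inverse mult.commute[of _ "inverse _"]
    by (intro periodic_integrable_cmult periodic_integrable_sum periodic_integrable_shift b) auto
  have "integral {0..1} W = (\<Sum>l<m. integral {0..1} (\<lambda>t. b (t + - (real l / real n)))) / real n"
    unfolding W_def Henstock_Kurzweil_Integration.integral_divide
    by (subst Henstock_Kurzweil_Integration.integral_sum)
       (auto simp del: add_uminus_conv_diff intro!: periodic_integrable_shift b)
  also have "\<dots> = real m * integral {0..1} b / real n"
    by (simp only: integral_period_shift[OF b(1)]) simp
  also have "\<dots> \<le> real m * \<alpha> 1 / real n"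
    using b(2) by (intro divide_right_mono mult_left_mono) auto
  finally have Wle: "integral {0..1} W \<le> real m * \<alpha> 1 / real n" .
  have "N (\<lambda>k. g t k - F 0 t k) \<le> W t" for t
    using norm_spline_diff_steklov_funpow_le[OF N n p, where x = t and t = t and a = 0 and j = m]
    by (simp add: F_def D_def W_def b_def g_def)
  then have "curve_dist N g (F 0) \<le> ennreal (real m * \<alpha> 1 / real n)"
    using bpos by (intro curve_dist_le[OF W _ Wle negligible_empty]) (auto simp: W_def intro!: divide_nonneg_nonneg sum_nonneg)
  with mem show ?thesis by blast
qed

lemma sobolev_near_spline:
  assumes N: "norm_on_Rd d N" and q: "q \<ge> (1::real)" and n: "n \<ge> 1" and m: "m \<ge> 1"
    and \<alpha>: "\<And>r. r \<le> m \<Longrightarrow> \<alpha> r > 0"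
    and f: "f \<in> sobolev_multiball d N m q \<alpha>"
  shows "\<exists>g\<in>spline_multiball d N m q n \<alpha>. curve_dist N g f \<le> ennreal (2 * \<alpha> 1 / real n)"
proof -
  obtain G where G: "\<And>r. r \<le> m \<Longrightarrow> G r \<in> periodic_L1 d"
    and weak: "\<And>r. r \<le> m \<Longrightarrow> periodic_weak_deriv d r f (G r)"
    and norm: "\<And>r. r \<le> m \<Longrightarrow> Lq_norm_le N q (G r) (\<alpha> r)"
    using f unfolding sobolev_multiball_def by simp metis
  have fR: "f t \<in> Rd d" and fpi: "periodic_integrable (\<lambda>t. f t k)" for t k
    using f by (auto simp: sobolev_multiball_def periodic_L1_iff)
  have GR: "G r t \<in> Rd d" and Gpi: "periodic_integrable (\<lambda>t. G r t k)" if "r \<le> m" for r t k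
    using G[OF that] by (auto simp: periodic_L1_iff)
  have K: "periodic_integrable (\<lambda>t. N (G r t) powr q)"
    and Kle: "integral {0..1} (\<lambda>t. N (G r t) powr q) \<le> \<alpha> r powr q" if r: "r \<le> m" for r
  proof -
    have per: "G r (t + 1) = G r t" for t
      using Gpi[OF r] by (auto simp: periodic_integrable_def)
    show "periodic_integrable (\<lambda>t. N (G r t) powr q)"
      "integral {0..1} (\<lambda>t. N (G r t) powr q) \<le> \<alpha> r powr q"
      using norm[OF r] \<alpha>[OF r] Lq_norm_le_iff[where g = "G r", OF per q, of "\<alpha> r" N] by auto
  qed
  have weakI: "integral {0..1} (\<lambda>t. G r t k * \<phi> t) = (-1) ^ r * integral {0..1} (\<lambda>t. f t k * (deriv ^^ r) \<phi> t)"
    if "r \<le> m" "smooth_periodic \<phi>" "k < d" for r k \<phi>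
    using weak[OF that(1)] that by (auto simp: periodic_weak_deriv_iff[OF fpi Gpi])
  have outside: "f t k = 0" "r \<le> m \<Longrightarrow> G r t k = 0" if "k \<ge> d" for r t k
    using that fR[of t] GR[of r t] by (auto simp: Rd_def)
  \<comment> \<open>The order 0 witness \<open>G 0\<close> is only tied to \<open>f\<close> through
    test functions, so equality holds off a null set.\<close>
  have "\<exists>Z. negligible Z \<and> (\<forall>t\<in>{0..1} - Z. f t k = G 0 t k)" for k
  proof (cases "k < d")
    case True
    let ?w = "\<lambda>t. f t k - G 0 t k"
    have "periodic_integrable ?w" by (intro periodic_integrable_diff fpi Gpi) simp
    then have w: "?w absolutely_integrable_on {0..1}" by (simp add: periodic_integrable_def)
    have zero: "integral {0..1} (\<lambda>t. ?w t * \<phi> t) = 0" if "trig_poly \<phi>" for \<phi>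
    proof -
      have \<phi>: "smooth_periodic \<phi>" by (rule trig_poly_smooth[OF that])
      have "(\<lambda>t. f t k * \<phi> t) integrable_on {0..1}" "(\<lambda>t. G 0 t k * \<phi> t) integrable_on {0..1}"
        using fpi Gpi[of 0]
        by (auto intro!: integrable_on_mult_continuous smooth_periodic_continuous_on[OF \<phi>] simp: periodic_integrable_def)
      then show ?thesis
        using weakI[of 0 \<phi> k] True \<phi> by (simp add: left_diff_distrib Henstock_Kurzweil_Integration.integral_diff)
    qed
    show ?thesis by (rule fundamental_lemma_periodic[OF w zero]) auto
  qed (use outside in \<open>auto intro!: exI[of _ "{}"]\<close>)
  then obtain Z0 where Z0: "\<And>k. negligible (Z0 k)" "\<And>t k. t \<in> {0..1} - Z0 k \<Longrightarrow> f t k = G 0 t k"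
    by metis
  have ex: "\<exists>U Z. periodic_integrable U \<and> (\<forall>s t. s \<le> t \<longrightarrow> U t - U s = integral {s..t} (\<lambda>x. G (Suc r) x k)) \<and>
      negligible Z \<and> (\<forall>t\<in>{0..1} - Z. G r t k = U t) \<and> (k \<ge> d \<longrightarrow> U = (\<lambda>t. 0))" if r: "r < m" for r k
  proof (cases "k < d")
    case True
    \<comment> \<open>The order \<open>r + 1\<close> identity for \<phi> and the order
      \<open>r\<close> identity for its derivative involve the same integral of \<open>f\<close>;
      hence consecutive witnesses are first-order weak derivatives of each other.\<close>
    have "integral {0..1} (\<lambda>t. G (Suc r) t k * \<phi> t) = - integral {0..1} (\<lambda>t. G r t k * deriv \<phi> t)"
      if \<phi>: "smooth_periodic \<phi>" for \<phi>
      using weakI[OF Suc_leI[OF r] \<phi> True] weakI[OF less_imp_le[OF r] smooth_periodic_deriv[OF \<phi>] True]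
      by (simp only: funpow_Suc_right o_apply) simp
    from weak_derivative_primitive[OF Gpi[OF less_imp_le[OF r]] Gpi[OF Suc_leI[OF r]] this]
    obtain U Z where "periodic_integrable U" "\<And>s t. s \<le> t \<Longrightarrow> U t - U s = integral {s..t} (\<lambda>x. G (Suc r) x k)"
      "negligible Z" "\<And>t. t \<in> {0..1} - Z \<Longrightarrow> G r t k = U t"
      by blast
    then show ?thesis using True by (intro exI[of _ U] exI[of _ Z]) auto
  next
    case False
    then show ?thesis
      using outside(2)[of k r] outside(2)[of k "Suc r"] r
      by (intro exI[of _ "\<lambda>t. 0"] exI[of _ "{}"]) (simp add: periodic_integrable_const)
  qed
  \<comment> \<open>With \<open>U\<close> the representative of \<open>G r\<close>: the averages of
    \<open>G r\<close> and \<open>U\<close> agree, difference and average commute on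
    \<open>U\<close>, and \<open>D U\<close> is the average of \<open>G (Suc r)\<close>.\<close>
  have comm: "bdiff n (steklov n (\<lambda>t. G r t k)) = steklov n (steklov n (\<lambda>t. G (Suc r) t k))" if r: "r < m" for r k
  proof -
    obtain U Z where U: "periodic_integrable U" "\<And>s t. s \<le> t \<Longrightarrow> U t - U s = integral {s..t} (\<lambda>t. G (Suc r) t k)"
      "negligible Z" "\<And>t. t \<in> {0..1} - Z \<Longrightarrow> G r t k = U t"
      using ex[OF r, of k] by blast
    have "bdiff n U = steklov n (\<lambda>t. G (Suc r) t k)"
      using U(2) by (auto simp: bdiff_def steklov_def)
    moreover have "steklov n (\<lambda>t. G r t k) = steklov n U"
      by (rule steklov_cong_negligible[OF n Gpi U(1,3,4)]) (use r in auto)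
    ultimately show ?thesis using bdiff_steklov[OF U(1)] by simp
  qed
  have iter: "(bdiff n ^^ r) (steklov n (\<lambda>t. G 0 t k)) = (steklov n ^^ Suc r) (\<lambda>t. G r t k)" if "r \<le> m" for r k
    using that
  proof (induction r)
    case (Suc r)
    have ur: "periodic_integrable (\<lambda>t. G r t k)" using Suc.prems by (intro Gpi) auto
    have "(bdiff n ^^ Suc r) (steklov n (\<lambda>t. G 0 t k)) = bdiff n ((steklov n ^^ Suc r) (\<lambda>t. G r t k))"
      using Suc by simp
    also have "\<dots> = bdiff n ((steklov n ^^ r) (steklov n (\<lambda>t. G r t k)))"
      by (simp only: funpow_Suc_right o_apply)
    also have "\<dots> = (steklov n ^^ r) (steklov n (steklov n (\<lambda>t. G (Suc r) t k)))"
      using Suc.prems by (simp add: bdiff_steklov_funpow[OF steklov_periodic_integrable[OF ur]] comm)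
    finally show ?case by (simp only: funpow_Suc_right o_apply)
  qed simp
  have st0: "steklov n (\<lambda>t. f t k) = steklov n (\<lambda>t. G 0 t k)" for k
    by (rule steklov_cong_negligible[OF n fpi Gpi Z0]) auto
  define p where "p i k = steklov n (\<lambda>t. f t k) (real (Suc i) / real n)" for i k
  define g where "g = zero_order_spline n p"
  have pR: "p i \<in> Rd d" for i
    using fR by (simp add: p_def Rd_def steklov_def)
  \<comment> \<open>The average is taken at the right end of the cell containing \<open>t\<close>,
    so its window is exactly that cell. Periodicity of the average absorbs the reduction of the
    index modulo \<open>n\<close>.\<close>
  have g: "g t k = steklov n (\<lambda>t. G 0 t k) (of_int (\<lfloor>real n * t\<rfloor> + 1) / real n)" for t k
  proof -
    let ?i = "\<lfloor>real n * t\<rfloor>"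
    have per: "steklov n (\<lambda>t. f t k) (x + 1) = steklov n (\<lambda>t. f t k) x" for x
      using steklov_periodic_integrable[OF fpi] by (simp add: periodic_integrable_def)
    have "of_int (?i + 1) / real n = real (Suc (nat (?i mod int n))) / real n + of_int (?i div int n)"
    proof -
      have "of_int ?i = (of_int (?i mod int n) :: real) + real n * of_int (?i div int n)"
        by (metis mult_div_mod_eq of_int_add of_int_mult of_int_of_nat_eq add.commute)
      then show ?thesis using n by (simp add: field_simps)
    qed
    then show ?thesis
      using periodic_add_int[of "steklov n (\<lambda>t. f t k)", OF per]
      by (simp only: g_def zero_order_spline_def cyclic_nth_def p_def st0)
  qed
  have Dg: "(bdiff n ^^ r) (\<lambda>t. g t k) t = (bdiff n ^^ r) (steklov n (\<lambda>t. G 0 t k)) (of_int (\<lfloor>real n * t\<rfloor> + 1) / real n)" for r k t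
  proof -
    have "of_int (\<lfloor>real n * t\<rfloor> - int j + 1) / real n = of_int (\<lfloor>real n * t\<rfloor> + 1) / real n - real j / real n" for j
      by (simp add: diff_divide_distrib[symmetric] algebra_simps)
    then show ?thesis
      by (simp only: bdiff_funpow_binomial g floor_shift_grid[OF n])
  qed
  have mem: "g \<in> spline_multiball d N m q n \<alpha>"
  proof -
    have "real n ^ r * lq_norm N q n (discrete_deriv n r p) \<le> \<alpha> r" if r: "r \<le> m" for r
    proof -
      let ?K = "\<lambda>t. N (G r t) powr q"
      \<comment> \<open>The grid point \<open>i / n\<close> opens cell \<open>i\<close>, whose right
        end is \<open>1 / n + i / n\<close>. After Jensen, \<open>steklov_grid_sum\<close> with base
        point \<open>1 / n\<close> evaluates the sum exactly.\<close>
      have "(\<Sum>i<n. N (\<lambda>k. (bdiff n ^^ r) (\<lambda>t. g t k) (real i / real n)) powr q) \<le>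
          (\<Sum>i<n. (steklov n ^^ Suc r) ?K (1 / real n + real i / real n))"
      proof (rule sum_mono)
        fix i assume "i \<in> {..<n}"
        have "real n * (real i / real n) = of_int (int i)" using n by simp
        then have eq: "(\<lambda>k. (bdiff n ^^ r) (\<lambda>t. g t k) (real i / real n)) =
            (\<lambda>k. (steklov n ^^ Suc r) (\<lambda>t. G r t k) (1 / real n + real i / real n))"
          unfolding Dg iter[OF r] by (simp only: floor_of_int) (simp add: add_divide_distrib add.commute)
        show "N (\<lambda>k. (bdiff n ^^ r) (\<lambda>t. g t k) (real i / real n)) powr q \<le>
            (steklov n ^^ Suc r) ?K (1 / real n + real i / real n)"
          unfolding eq by (rule norm_steklov_funpow_powr_le[OF N q n GR[OF r] Gpi[OF r] K[OF r] order.refl])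
      qed
      also have "\<dots> = real n * integral {0..1} ?K" by (rule steklov_grid_sum[OF n K[OF r]])
      finally have "(\<Sum>i<n. N (\<lambda>k. (bdiff n ^^ r) (\<lambda>t. g t k) (real i / real n)) powr q) / real n \<le> integral {0..1} ?K"
        using n by (simp add: field_simps)
      with Kle[OF r] show ?thesis
        using discrete_norm_le_iff[OF N q n less_imp_le[OF \<alpha>[OF r]] pR, where r = r] by (simp add: g_def)
    qed
    then show ?thesis
      using pR by (auto simp: spline_multiball_def discrete_multiball_def g_def)
  qed
  define b where "b = (\<lambda>t. N (G 1 t))"
  have bpos: "b t \<ge> 0" for t unfolding b_def by (rule N_nonneg[OF N GR[OF m]])
  have b: "periodic_integrable b" "integral {0..1} b \<le> \<alpha> 1"
    using L1_le_of_powr[where h = b, OF bpos q \<alpha>[OF m]] K[OF m] Kle[OF m] by (simp_all add: b_def)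
  \<comment> \<open>This is the integral of \<open>b\<close> over \<open>[t - 1/n, t + 1/n]\<close>,
    which covers the cell of \<open>t\<close>. Written with averages, its mean is visibly
    \<open>2 / n\<close> times that of \<open>b\<close>.\<close>
  define W where "W = (\<lambda>t. (1 / real n) * (steklov n b t + steklov n b (t + 1 / real n)))"
  have Wpi: "periodic_integrable W"
    unfolding W_def
    by (intro periodic_integrable_cmult periodic_integrable_add periodic_integrable_shift
        steklov_periodic_integrable b)
  have Wint: "W t = integral {t - 1 / real n..t + 1 / real n} b" for t
  proof -
    have "W t = integral {t - 1 / real n..t} b + integral {t..t + 1 / real n} b"
      using n by (simp add: W_def steklov_def add_divide_distrib)
    also have "\<dots> = integral {t - 1 / real n..t + 1 / real n} b"
      by (rule periodic_integral_combine[OF b(1)]) auto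
    finally show ?thesis .
  qed
  have "integral {0..1} W = (1 / real n) * (integral {0..1} b + integral {0..1} b)"
    using integral_period_shift[OF steklov_periodic_integrable[OF b(1)], of n "1 / real n"]
      integral_steklov_funpow[OF n b(1), of 1] 
      periodic_integrable_shift[OF steklov_periodic_integrable[OF b(1)], of n "1 / real n"]
      steklov_periodic_integrable[OF b(1), of n]
    by (simp add: W_def Henstock_Kurzweil_Integration.integral_add periodic_integrable_integrable_on)
  also have "\<dots> \<le> 2 * \<alpha> 1 / real n"
    using b(2) n by (simp add: field_simps)
  finally have Wle: "integral {0..1} W \<le> 2 * \<alpha> 1 / real n" .
  \<comment> \<open>Bundles the properties so that representatives and null sets are chosen for all
    coordinates together; the last clause keeps the resulting curve \<open>V\<close> in
    \<open>Rd d\<close>.\<close>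
  define P where "P k U Z \<longleftrightarrow> periodic_integrable U \<and>
      (\<forall>s t. s \<le> t \<longrightarrow> U t - U s = integral {s..t} (\<lambda>x. G 1 x k)) \<and>
      negligible Z \<and> (\<forall>t\<in>{0..1} - Z. G 0 t k = U t) \<and> (k \<ge> d \<longrightarrow> U = (\<lambda>t. 0))" for k U Z
  have "\<exists>U Z. P k U Z" for k
    using ex[of 0 k] m unfolding P_def by simp
  then obtain U Z where UZ: "\<And>k. P k (U k) (Z k)"
    by metis
  have U: "\<And>k. periodic_integrable (U k)"
    "\<And>k s t. s \<le> t \<Longrightarrow> U k t - U k s = integral {s..t} (\<lambda>x. G 1 x k)"
    and Z: "\<And>k. negligible (Z k)" "\<And>k t. t \<in> {0..1} - Z k \<Longrightarrow> G 0 t k = U k t"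
    and Uout: "\<And>k. k \<ge> d \<Longrightarrow> U k = (\<lambda>t. 0)"
    using UZ unfolding P_def by blast+
  define V where "V t k = U k t" for t k
  have VR: "V t \<in> Rd d" for t using Uout by (simp add: V_def Rd_def)
  have Vinc: "N (\<lambda>k. V t k - V s k) \<le> integral {s..t} b" if "s \<le> t" for s t
    using norm_integral_le[OF N GR[OF m], where a = s and b = t] Gpi[OF m] b(1) U(2)[OF that]
    by (auto simp: V_def b_def periodic_integrable_integrable_on)
  define Z' where "Z' = (\<Union>k<d. Z k \<union> Z0 k)"
  have "negligible Z'" unfolding Z'_def using Z(1) Z0(1) by (intro negligible_Union) auto
  moreover have "N (\<lambda>k. g t k - f t k) \<le> W t" if t: "t \<in> {0..1} - Z'" for t
  proof -
    have fV: "f t = V t"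
    proof
      show "f t k = V t k" for k
        using t Z0(2)[of t k] Z(2)[of t k] outside(1)[of k] Uout[of k]
        by (cases "k < d") (auto simp: V_def Z'_def)
    qed
    define y where "y = of_int (\<lfloor>real n * t\<rfloor> + 1) / real n"
    have gV: "g t k = steklov n (\<lambda>t. V t k) y" for k
      unfolding g y_def[symmetric] V_def
      by (subst steklov_cong_negligible[OF n Gpi U(1) Z]) auto
    have ty: "t \<in> {y - 1 / real n..y}"
    proof -
      have "real n * y = of_int \<lfloor>real n * t\<rfloor> + 1" using n by (simp add: y_def)
      then have "real n * t \<le> real n * y" "real n * y \<le> real n * t + 1" by linarith+
      then show ?thesis using n by (simp add: field_simps)
    qed
    have "N (\<lambda>k. V t k - steklov n (\<lambda>t. V t k) y) \<le> W t"
    proof (rule norm_diff_steklov_le[OF N n VR VR])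
      show "periodic_integrable (\<lambda>t. V t k)" for k using U(1) by (simp add: V_def)
      fix s assume s: "s \<in> {y - 1 / real n..y}"
      \<comment> \<open>The point \<open>s\<close> may lie on either side of \<open>t\<close>, but
        both belong to one closed cell of length \<open>1/n\<close>.\<close>
      have "N (\<lambda>k. V t k - V s k) \<le> integral {min s t..max s t} b"
        using Vinc[of s t] Vinc[of t s] N_minus_commute[OF N VR VR, of t s]
        by (cases "s \<le> t") (auto simp: min_def max_def)
      also have "\<dots> \<le> integral {t - 1 / real n..t + 1 / real n} b"
        using s ty by (intro integral_subset_le periodic_integrable_integrable_on b(1)) (auto simp: bpos)
      finally show "N (\<lambda>k. V t k - V s k) \<le> W t" by (simp add: Wint)
    qed
    moreover have "g t \<in> Rd d"
      using pR by (simp add: g_def zero_order_spline_def cyclic_nth_def)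
    ultimately show ?thesis
      unfolding N_minus_commute[OF N \<open>g t \<in> Rd d\<close> fR] by (simp add: fV gV)
  qed
  moreover have "W t \<ge> 0" for t
    unfolding Wint by (intro integral_nonneg periodic_integrable_integrable_on b(1)) (auto simp: bpos)
  ultimately show ?thesis
    using mem curve_dist_le[OF Wpi _ Wle] by blast
qed

theorem theorem2p1:
  fixes m :: nat and \<alpha> :: "nat \<Rightarrow> real"
  assumes "m \<ge> 1" and "\<forall>r\<le>m. \<alpha> r > 0"
  shows "\<exists>\<kappa>::real. \<kappa> \<ge> 0 \<and>
    (\<forall>(d::nat) (N :: (nat \<Rightarrow> real) \<Rightarrow> real) (q::real) (n::nat).
       d \<ge> 1 \<longrightarrow> norm_on_Rd d N \<longrightarrow> q \<ge> 1 \<longrightarrow> n \<ge> 1 \<longrightarrow>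
       curve_hausdorff N (spline_multiball d N m q n \<alpha>) (sobolev_multiball d N m q \<alpha>)
         \<le> ennreal (\<kappa> / real n))"
\<comment> \<open>The witness adds the factors \<open>m\<close> and 2 of the two one-sided
  estimates; neither involves \<open>d\<close>, \<open>N\<close> or \<open>q\<close>. Index 1 is
  available because \<open>m \<ge> 1\<close>.\<close>
proof (intro exI[of _ "(real m + 2) * \<alpha> 1"] conjI allI impI)
  have \<alpha>: "\<And>r. r \<le> m \<Longrightarrow> \<alpha> r > 0" using assms(2) by blast
  have \<alpha>1: "\<alpha> 1 > 0" by (rule \<alpha>[OF assms(1)])
  then show "0 \<le> (real m + 2) * \<alpha> 1" by simp
  fix d N and q :: real and n :: nat
  assume N: "norm_on_Rd d N" and q: "q \<ge> 1" and n: "n \<ge> 1"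
  let ?A = "spline_multiball d N m q n \<alpha>" and ?B = "sobolev_multiball d N m q \<alpha>"
  have "(SUP g\<in>?A. INF f\<in>?B. curve_dist N g f) \<le> ennreal (real m * \<alpha> 1 / real n)"
  proof (rule SUP_least)
    fix g assume "g \<in> ?A"
    from spline_near_sobolev[where \<alpha> = \<alpha>, OF N q n assms(1) \<alpha> this]
    show "(INF f\<in>?B. curve_dist N g f) \<le> ennreal (real m * \<alpha> 1 / real n)"
      by (auto intro: INF_lower2)
  qed
  moreover have "(SUP f\<in>?B. INF g\<in>?A. curve_dist N g f) \<le> ennreal (2 * \<alpha> 1 / real n)"
  proof (rule SUP_least)
    fix f assume "f \<in> ?B"
    from sobolev_near_spline[where \<alpha> = \<alpha>, OF N q n assms(1) \<alpha> this]
    show "(INF g\<in>?A. curve_dist N g f) \<le> ennreal (2 * \<alpha> 1 / real n)"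
      by (auto intro: INF_lower2)
  qed
  ultimately have "curve_hausdorff N ?A ?B \<le> ennreal (real m * \<alpha> 1 / real n) + ennreal (2 * \<alpha> 1 / real n)"
    unfolding curve_hausdorff_def by (rule add_mono)
  also have "\<dots> = ennreal ((real m + 2) * \<alpha> 1 / real n)"
    using \<alpha>1 by (simp add: ennreal_plus[symmetric] distrib_right add_divide_distrib del: ennreal_plus)
  finally show "curve_hausdorff N ?A ?B \<le> ennreal ((real m + 2) * \<alpha> 1 / real n)" .
qed

end
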